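(* Assume $\Sigma^+$ is compact and $T_{\mathfrak s}$ is transitive. Let $0\ne f\in\mathcal H_+$ with $\gamma:=\gamma(\phi\ast_\rho f)<1$, and let $\Upsilon_c$ and $\nu_c^{\phi\ast_\rho f}$ be the function on $G$ and the twisted measure on $\Sigma^+$ obtained along a sequence $t_k\to\gamma$. Then for every $\epsilon\in(0,1)$ and every $v\in\mathcal H_+$, for $\nu_c^{\phi\ast_\rho f}$-almost every $z\in\Sigma^+$ there is $N$ such that $$n\ge N\implies\langle\rho(\underline{\mathfrak s}(z_0\cdots z_{n-1}))f,v\rangle_{\mathcal H}\le(1-\epsilon)^{-n}\,\Upsilon_c(\underline{\mathfrak s}(z_0\cdots z_{n-1})).$$ In addition, for $\nu_c^{\phi\ast_\rho f}$-almost every $z\in\Sigma^+$ there is $N$ such that $$n\ge N\implies\Upsilon_c(\underline{\mathfrak s}(z_0\cdots z_{n-1}))\ge n^{-2}\gamma^n .$$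
   Context: Shift. $\mathcal W_1$ is a finite alphabet ($\Sigma^+$ compact), $\tau$ a $0$-$1$ transition matrix, $\Sigma^+=\{x=(x_0,x_1,\dots):\tau(x_i,x_{i+1})=1\}$ with left shift $\sigma$, topologically mixing. $\mathcal W_n^{B,b}$ is the set of admissible words of length $n$ with first letter $B$, last letter $b$. $R:\Sigma^+\to(0,\infty)$ satisfies $|\log R(x)-\log R(y)|\le C\theta^n$ whenever $x,y$ agree in the first $n\ge2$ coordinates ($C>0$, $\theta<1$); $R_n(x)=R(x)\cdots R(\sigma^{n-1}x)$; the pressure $\limsup_n\frac1n\log\sum_{\sigma^nx=x,\,x_0=B}R_n(x)$ is normalised to $0$. Group. $G$ is a countable discrete group, $\mathfrak s:\mathcal W_1\to G$, $\underline{\mathfrak s}(w)=\mathfrak s(w_1)\cdots\mathfrak s(w_n)$, $T_{\mathfrak s}(x,g)=(\sigma x,\mathfrak s(x_0)^{-1}g)$ on $\Sigma^+\times G$; transitive means: for all $b,b'\in\mathcal W_1$, $g\in G$ there are $n\ge1$, $x\in\Sigma^+$ with $x_0=b$, $x_n=b'$, $\underline{\mathfrak s}(x_0\cdots x_{n-1})=g$. $\rho$ on the real Hilbert space $\mathcal H$ is a quotient representation $\lambda_H$ on $\ell^2(G/H)$, $[\lambda_H(g)f](yH)=f(g^{-1}yH)$ ($H\le G$), or a countable direct sum of such; $\mathcal H_+$ is the cone of vectors with non-negative components. Densities. Fix $A,a\in\mathcal W_1$ with $aA$ admissible and $x\in\Sigma^+$ with $x_0=A$, $x_i\ne A$ for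 $i\ge1$. $\phi_{c;\le N}[t](g)=\sum_{n=1}^Nt^{-n}c_n\sum_{w\in\mathcal W_n^{A,a}:\underline{\mathfrak s}(w)=g}R_n(wx)$, $\phi_c[t]=\lim_N\phi_{c;\le N}[t]$; $\phi_{\le N}$ is the case $c\equiv1$; $\phi\ast_\rho f=\sum_g\phi(g)\rho(g)f$. $\gamma(\phi\ast_\rho f)=\inf\{t>0:\sup_N\|\phi_{\le N}[t]\ast_\rho f\|<\infty\}$. $\Upsilon_c$ and $\nu_c^{\phi\ast_\rho f}$. $c:\mathbb N\to(0,\infty)$ is slowly increasing (non-decreasing, $c_{n+1}/c_n\to1$) with $\|\phi_c[t]\ast_\rho f\|<\infty$ for $t>\gamma$ and $\|\phi_c[t]\ast_\rho f\|\to\infty$ as $t\downarrow\gamma$. For $t>\gamma$ let $$\nu_c[t]=\sum_{B\in\mathcal W_1}\sum_{n=1}^\infty t^{-n}c_n\sum_{v\in\mathcal W_n^{B,a}}R_n(vx)\frac{\langle\rho(\underline{\mathfrak s}(v))f,\phi_c[t]\ast_\rho f\rangle}{\|\phi_c[t]\ast_\rho f\|^2}D(vx),$$ $D(z)$ the Dirac mass at $z$. $(t_k)$ is a sequence with $t_k>\gamma$, $t_k\to\gamma$, along which $\nu_c[t_k]$ converges weak-$*$ to $\nu_c^{\phi\ast_\rho f}$ and $\Upsilon_c(g)=\lim_k\langle\rho(g)\phi_c[t_k]\ast_\rho f,\phi_c[t_k]\ast_\rho f\rangle/\|\phi_c[t_k]\ast_\rho f\|^2$ exists for every $g\in G$.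 *)

theory Defs
  imports
    "HOL-Analysis.Analysis"
    "HOL-Algebra.Left_Coset"
    "HOL-Library.Omega_Words_Fun"
begin

section \<open>The real Hilbert space of square summable functions\<close>

typedef 'y ell2 = "{f :: 'y \<Rightarrow> real. (\<lambda>y. (f y)\<^sup>2) summable_on UNIV}"
  morphisms coord Abs_ell2
  by (rule exI[of _ "\<lambda>_. 0"]) simp

setup_lifting type_definition_ell2

lemma ell2_prod_summable:
  fixes f g :: "'y \<Rightarrow> real"
  assumes "(\<lambda>y. (f y)\<^sup>2) summable_on UNIV" "(\<lambda>y. (g y)\<^sup>2) summable_on UNIV"
  shows "(\<lambda>y. f y * g y) summable_on UNIV"
proof (rule abs_summable_summable, rule abs_summable_product)
  show "(\<lambda>y. norm (f y * f y)) summable_on UNIV" "(\<lambda>y. norm (g y * g y)) summable_on UNIV"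
    using assms by (simp_all add: power2_eq_square)
qed

lemma ell2_add_summable:
  fixes f g :: "'y \<Rightarrow> real"
  assumes "(\<lambda>y. (f y)\<^sup>2) summable_on UNIV" "(\<lambda>y. (g y)\<^sup>2) summable_on UNIV"
  shows "(\<lambda>y. (f y + g y)\<^sup>2) summable_on UNIV"
proof -
  have "(\<lambda>y. (f y)\<^sup>2 + (g y)\<^sup>2 + 2 * (f y * g y)) summable_on UNIV"
    by (intro summable_on_add summable_on_cmult_right assms ell2_prod_summable)
  then show ?thesis
    by (simp add: power2_sum algebra_simps)
qed

lemma ell2_minus_summable:
  fixes f g :: "'y \<Rightarrow> real"
  assumes "(\<lambda>y. (f y)\<^sup>2) summable_on UNIV" "(\<lambda>y. (g y)\<^sup>2) summable_on UNIV"
  shows "(\<lambda>y. (f y - g y)\<^sup>2) summable_on UNIV"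
  using ell2_add_summable[OF assms(1), of "\<lambda>y. - g y"] assms(2) by simp

instantiation ell2 :: (type) real_inner
begin

lift_definition zero_ell2 :: "'a ell2" is "\<lambda>_. 0" by simp
lift_definition uminus_ell2 :: "'a ell2 \<Rightarrow> 'a ell2" is "\<lambda>f y. - f y" by simp
lift_definition plus_ell2 :: "'a ell2 \<Rightarrow> 'a ell2 \<Rightarrow> 'a ell2" is "\<lambda>f g y. f y + g y"
  by (rule ell2_add_summable)
lift_definition minus_ell2 :: "'a ell2 \<Rightarrow> 'a ell2 \<Rightarrow> 'a ell2" is "\<lambda>f g y. f y - g y"
  by (rule ell2_minus_summable)
lift_definition scaleR_ell2 :: "real \<Rightarrow> 'a ell2 \<Rightarrow> 'a ell2" is "\<lambda>r f y. r * f y"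
  by (simp add: power_mult_distrib summable_on_cmult_right)
lift_definition inner_ell2 :: "'a ell2 \<Rightarrow> 'a ell2 \<Rightarrow> real" is "\<lambda>f g. \<Sum>\<^sub>\<infinity>y. f y * g y" .

definition norm_ell2 :: "'a ell2 \<Rightarrow> real" where "norm_ell2 f = sqrt (inner f f)"
definition sgn_ell2 :: "'a ell2 \<Rightarrow> 'a ell2" where "sgn_ell2 f = inverse (norm f) *\<^sub>R f"
definition dist_ell2 :: "'a ell2 \<Rightarrow> 'a ell2 \<Rightarrow> real" where "dist_ell2 f g = norm (f - g)"
definition uniformity_ell2 :: "('a ell2 \<times> 'a ell2) filter"
  where "uniformity_ell2 = (INF e\<in>{0<..}. principal {(f, g). dist f g < e})"
definition open_ell2 :: "'a ell2 set \<Rightarrow> bool"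
  where "open_ell2 U = (\<forall>f\<in>U. eventually (\<lambda>(f', g). f' = f \<longrightarrow> g \<in> U) uniformity)"

instance
proof
  fix r s :: real and f g h :: "'a ell2"
  show "f + g + h = f + (g + h)" by transfer (simp add: add.assoc)
  show "f + g = g + f" by transfer (simp add: add.commute)
  show "0 + f = f" by transfer simp
  show "- f + f = 0" by transfer simp
  show "f - g = f + - g" by transfer simp
  show "r *\<^sub>R (f + g) = r *\<^sub>R f + r *\<^sub>R g" by transfer (simp add: distrib_left)
  show "(r + s) *\<^sub>R f = r *\<^sub>R f + s *\<^sub>R f" by transfer (simp add: distrib_right)
  show "r *\<^sub>R s *\<^sub>R f = (r * s) *\<^sub>R f" by transfer (simp add: mult.assoc)
  show "1 *\<^sub>R f = f" by transfer simp
  show "dist f g = norm (f - g)" by (rule dist_ell2_def)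
  show "sgn f = inverse (norm f) *\<^sub>R f" by (rule sgn_ell2_def)
  show "(uniformity :: ('a ell2 \<times> 'a ell2) filter) = (INF e\<in>{0<..}. principal {(f, g). dist f g < e})"
    by (rule uniformity_ell2_def)
  show "open U = (\<forall>f\<in>U. eventually (\<lambda>(f', g). f' = f \<longrightarrow> g \<in> U) uniformity)" for U :: "'a ell2 set"
    by (rule open_ell2_def)
  show "inner f g = inner g f" by transfer (simp add: mult.commute)
  show "inner (f + g) h = inner f h + inner g h"
    by transfer (simp add: distrib_right infsum_add ell2_prod_summable)
  show "inner (r *\<^sub>R f) g = r * inner f g"
    by transfer (simp add: mult.assoc infsum_cmult_right')
  show "0 \<le> inner f f" by transfer (simp add: infsum_nonneg)
  show "inner f f = 0 \<longleftrightarrow> f = 0"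
  proof transfer
    fix u :: "'a \<Rightarrow> real" assume u: "(\<lambda>y. (u y)\<^sup>2) summable_on UNIV"
    show "(\<Sum>\<^sub>\<infinity>y. u y * u y) = 0 \<longleftrightarrow> u = (\<lambda>_. 0)"
    proof
      assume "(\<Sum>\<^sub>\<infinity>y. u y * u y) = 0"
      then have "u y * u y = 0" for y
        by (intro nonneg_infsum_le_0D[of "\<lambda>y. u y * u y" UNIV])
          (use u in \<open>auto simp: power2_eq_square\<close>)
      then show "u = (\<lambda>_. 0)" by auto
    qed simp
  qed
  show "norm f = sqrt (inner f f)" by (rule norm_ell2_def)
qed

end

lemma ell2_norm_square: "(norm f)\<^sup>2 = (\<Sum>\<^sub>\<infinity>y. (coord f y)\<^sup>2)"
  unfolding power2_norm_eq_inner inner_ell2.rep_eq by (simp add: power2_eq_square)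

lemma ell2_sum_le_norm:
  assumes "finite F"
  shows "(\<Sum>y\<in>F. (coord f y)\<^sup>2) \<le> (norm f)\<^sup>2"
proof -
  have "(\<Sum>y\<in>F. (coord f y)\<^sup>2) \<le> (\<Sum>\<^sub>\<infinity>y. (coord f y)\<^sup>2)"
    using coord[of f] assms by (intro finite_sum_le_infsum) auto
  then show ?thesis by (simp add: ell2_norm_square)
qed

lemma ell2_norm_le:
  assumes "\<And>F. finite F \<Longrightarrow> (\<Sum>y\<in>F. (coord f y)\<^sup>2) \<le> e\<^sup>2" "e \<ge> 0"
  shows "norm f \<le> e"
proof -
  have "(\<Sum>\<^sub>\<infinity>y. (coord f y)\<^sup>2) \<le> e\<^sup>2"
    using coord[of f] assms by (intro infsum_le_finite_sums) auto
  then have "(norm f)\<^sup>2 \<le> e\<^sup>2"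
    by (simp add: ell2_norm_square)
  then show ?thesis using assms(2) by (rule power2_le_imp_le)
qed

instance ell2 :: (type) complete_space
proof
  fix X :: "nat \<Rightarrow> 'a ell2" assume "Cauchy X"
  have diff: "coord (f - g) y = coord f y - coord g y" for f g :: "'a ell2" and y
    by (simp add: minus_ell2.rep_eq)
  have bound: "\<bar>coord f y\<bar> \<le> norm f" for f :: "'a ell2" and y
    using ell2_sum_le_norm[of "{y}" f] abs_le_square_iff[of "coord f y" "norm f"] by simp
  have "Cauchy (\<lambda>n. coord (X n) y)" for y
  proof (rule metric_CauchyI)
    fix e :: real assume "e > 0"
    then obtain M where M: "\<And>m n. m \<ge> M \<Longrightarrow> n \<ge> M \<Longrightarrow> dist (X m) (X n) < e"
      using metric_CauchyD[OF \<open>Cauchy X\<close> \<open>e > 0\<close>] by auto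
    have le: "dist (coord (X m) y) (coord (X n) y) \<le> dist (X m) (X n)" for m n
      using bound[of "X m - X n" y] unfolding dist_norm by (simp add: diff)
    show "\<exists>M. \<forall>m\<ge>M. \<forall>n\<ge>M. dist (coord (X m) y) (coord (X n) y) < e"
      by (intro exI[of _ M] allI impI le_less_trans[OF le] M)
  qed
  then have "\<exists>l. (\<lambda>n. coord (X n) y) \<longlonglongrightarrow> l" for y
    unfolding convergent_def[symmetric] by (rule Cauchy_convergent)
  then obtain l where l: "\<And>y. (\<lambda>n. coord (X n) y) \<longlonglongrightarrow> l y" by metis
  have close: "(\<Sum>y\<in>F. (coord (X m) y - l y)\<^sup>2) \<le> e\<^sup>2"
    if "finite F" "\<forall>m\<ge>M. \<forall>n\<ge>M. dist (X m) (X n) < e" "m \<ge> M" for F M e m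
  proof (rule LIMSEQ_le_const2)
    show "(\<lambda>n. \<Sum>y\<in>F. (coord (X m) y - coord (X n) y)\<^sup>2) \<longlonglongrightarrow> (\<Sum>y\<in>F. (coord (X m) y - l y)\<^sup>2)"
      by (intro tendsto_intros l)
    have "(\<Sum>y\<in>F. (coord (X m) y - coord (X n) y)\<^sup>2) \<le> e\<^sup>2" if "n \<ge> M" for n
    proof -
      have "norm (X m - X n) \<le> e" using \<open>n \<ge> M\<close> that \<open>m \<ge> M\<close>
          \<open>\<forall>m\<ge>M. \<forall>n\<ge>M. dist (X m) (X n) < e\<close> by (simp add: dist_norm less_imp_le)
      then have "(norm (X m - X n))\<^sup>2 \<le> e\<^sup>2" by (simp add: power_mono)
      then show ?thesis
        using ell2_sum_le_norm[OF \<open>finite F\<close>, of "X m - X n"] by (simp add: diff)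
    qed
    then show "\<exists>N. \<forall>n\<ge>N. (\<Sum>y\<in>F. (coord (X m) y - coord (X n) y)\<^sup>2) \<le> e\<^sup>2" by blast
  qed
  obtain M where M: "\<forall>m\<ge>M. \<forall>n\<ge>M. dist (X m) (X n) < 1"
    using metric_CauchyD[OF \<open>Cauchy X\<close> zero_less_one] by auto
  have "(\<lambda>y. (coord (X M) y - l y)\<^sup>2) summable_on UNIV"
  proof (rule nonneg_bdd_above_summable_on)
    show "bdd_above (sum (\<lambda>y. (coord (X M) y - l y)\<^sup>2) ` {F. F \<subseteq> UNIV \<and> finite F})"
      using close[OF _ M order_refl] by (intro bdd_aboveI2[of _ _ "1\<^sup>2"]) simp
  qed simp
  then have "(\<lambda>y. (coord (X M) y - (coord (X M) y - l y))\<^sup>2) summable_on UNIV"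
    using ell2_minus_summable[of "coord (X M)" "\<lambda>y. coord (X M) y - l y"] coord[of "X M"] by simp
  then have L: "coord (Abs_ell2 l) = l" by (simp add: Abs_ell2_inverse)
  have "X \<longlonglongrightarrow> Abs_ell2 l"
  proof (rule metric_LIMSEQ_I)
    fix e :: real assume "e > 0"
    then obtain K where K: "\<forall>m\<ge>K. \<forall>n\<ge>K. dist (X m) (X n) < e / 2"
      using metric_CauchyD[OF \<open>Cauchy X\<close>, of "e / 2"] by auto
    have "norm (X m - Abs_ell2 l) \<le> e / 2" if "m \<ge> K" for m
      using close[OF _ K that] \<open>e > 0\<close> by (intro ell2_norm_le) (auto simp: diff L)
    then show "\<exists>K. \<forall>m\<ge>K. dist (X m) (Abs_ell2 l) < e"
      using \<open>e > 0\<close> by (intro exI[of _ K] allI impI) (rule le_less_trans[of _ "e / 2"], auto simp: dist_norm)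
  qed
  then show "convergent X" by (auto simp: convergent_def)
qed

instance ell2 :: (type) banach ..


section \<open>The shift space\<close>

definition shift_space :: "('a \<Rightarrow> 'a \<Rightarrow> bool) \<Rightarrow> 'a word set" where
  "shift_space \<tau> = {x. \<forall>i. \<tau> (x i) (x (Suc i))}"

definition shift_top :: "('a \<Rightarrow> 'a \<Rightarrow> bool) \<Rightarrow> 'a word topology" where
  "shift_top \<tau> = subtopology (product_topology (\<lambda>_. discrete_topology UNIV) UNIV) (shift_space \<tau>)"

definition shift_borel :: "('a \<Rightarrow> 'a \<Rightarrow> bool) \<Rightarrow> 'a word measure" where
  "shift_borel \<tau> = sigma (shift_space \<tau>) {U. openin (shift_top \<tau>) U}"

text \<open>The \<open>n\<close>-th iterate of the left shift is \<^term>\<open>suffix n\<close>, the word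
  \<open>z\<^sub>0 \<dots> z\<^bsub>n-1\<^esub>\<close> is \<^term>\<open>prefix n z\<close>, and concatenation is \<^term>\<open>v \<frown> x\<close>.\<close>

definition topologically_mixing :: "('a \<Rightarrow> 'a \<Rightarrow> bool) \<Rightarrow> bool" where
  "topologically_mixing \<tau> \<longleftrightarrow>
    (\<forall>U V. openin (shift_top \<tau>) U \<and> openin (shift_top \<tau>) V \<and> U \<noteq> {} \<and> V \<noteq> {} \<longrightarrow>
      (\<exists>N. \<forall>n\<ge>N. \<exists>x\<in>U. suffix n x \<in> V))"

definition words :: "('a \<Rightarrow> 'a \<Rightarrow> bool) \<Rightarrow> nat \<Rightarrow> 'a \<Rightarrow> 'a \<Rightarrow> 'a list set" where
  "words \<tau> n B b = {w. length w = n \<and> w \<noteq> [] \<and> successively \<tau> w \<and> hd w = B \<and> last w = b}"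

definition log_regular :: "('a \<Rightarrow> 'a \<Rightarrow> bool) \<Rightarrow> ('a word \<Rightarrow> real) \<Rightarrow> bool" where
  "log_regular \<tau> R \<longleftrightarrow> (\<exists>C>0. \<exists>\<theta><1. \<forall>x\<in>shift_space \<tau>. \<forall>y\<in>shift_space \<tau>. \<forall>n\<ge>2.
      prefix n x = prefix n y \<longrightarrow> \<bar>ln (R x) - ln (R y)\<bar> \<le> C * \<theta> ^ n)"

definition birkhoff_prod :: "('a word \<Rightarrow> real) \<Rightarrow> nat \<Rightarrow> 'a word \<Rightarrow> real" where
  "birkhoff_prod R n x = (\<Prod>i<n. R (suffix i x))"

text \<open>By mixing, the sum over periodic points is positive for all large \<open>n\<close>, so the convention
  \<^prop>\<open>ln (0::real) = 0\<close> does not affect the upper limit.\<close>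

definition pressure :: "('a \<Rightarrow> 'a \<Rightarrow> bool) \<Rightarrow> ('a word \<Rightarrow> real) \<Rightarrow> 'a \<Rightarrow> ereal" where
  "pressure \<tau> R B = limsup (\<lambda>n. ereal (1 / real n *
      ln (\<Sum>x\<in>{x \<in> shift_space \<tau>. suffix n x = x \<and> x 0 = B}. birkhoff_prod R n x)))"

definition weak_star_limit :: "'z topology \<Rightarrow> (nat \<Rightarrow> 'z measure) \<Rightarrow> 'z measure \<Rightarrow> bool" where
  "weak_star_limit X Ms M \<longleftrightarrow>
    (\<forall>k. finite_measure (Ms k) \<and> sets (Ms k) = sigma_sets (topspace X) {U. openin X U}) \<and>
    finite_measure M \<and> sets M = sigma_sets (topspace X) {U. openin X U} \<and>
    (\<forall>h. continuous_map X euclideanreal h \<longrightarrow>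
      (\<lambda>k. integral\<^sup>L (Ms k) h) \<longlonglongrightarrow> integral\<^sup>L M h)"


section \<open>Group extensions and quotient representations\<close>

definition word_prod :: "('g, 'm) monoid_scheme \<Rightarrow> ('a \<Rightarrow> 'g) \<Rightarrow> 'a list \<Rightarrow> 'g" where
  "word_prod G s w = foldr (\<lambda>b h. s b \<otimes>\<^bsub>G\<^esub> h) w \<one>\<^bsub>G\<^esub>"

definition transitive_extension ::
    "('a \<Rightarrow> 'a \<Rightarrow> bool) \<Rightarrow> ('g, 'm) monoid_scheme \<Rightarrow> ('a \<Rightarrow> 'g) \<Rightarrow> bool" where
  "transitive_extension \<tau> G s \<longleftrightarrow> (\<forall>b b'. \<forall>g\<in>carrier G. \<exists>n\<ge>1. \<exists>x\<in>shift_space \<tau>.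
      x 0 = b \<and> x n = b' \<and> word_prod G s (prefix n x) = g)"

text \<open>The direct sum over \<open>i \<in> I\<close> of the spaces \<open>\<ell>\<^sup>2(G/H\<^sub>i)\<close> is realised as the closed subspace
  of those \<open>\<ell>\<^sup>2\<close>-functions that vanish off the disjoint union of the coset spaces \<open>G/H\<^sub>i\<close>;
  a single quotient representation is the case of a one-element \<open>I\<close>.\<close>

definition coset_points :: "('g, 'm) monoid_scheme \<Rightarrow> 'i set \<Rightarrow> ('i \<Rightarrow> 'g set) \<Rightarrow> ('i \<times> 'g set) set" where
  "coset_points G I H = (SIGMA i:I. lcosets\<^bsub>G\<^esub> (H i))"

definition rep_space ::
    "('g, 'm) monoid_scheme \<Rightarrow> 'i set \<Rightarrow> ('i \<Rightarrow> 'g set) \<Rightarrow> ('i \<times> 'g set) ell2 set" where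
  "rep_space G I H = {f. \<forall>p. p \<notin> coset_points G I H \<longrightarrow> coord f p = 0}"

definition rep_cone ::
    "('g, 'm) monoid_scheme \<Rightarrow> 'i set \<Rightarrow> ('i \<Rightarrow> 'g set) \<Rightarrow> ('i \<times> 'g set) ell2 set" where
  "rep_cone G I H = {f \<in> rep_space G I H. \<forall>p. coord f p \<ge> 0}"

definition quot_rep :: "('g, 'm) monoid_scheme \<Rightarrow> 'i set \<Rightarrow> ('i \<Rightarrow> 'g set) \<Rightarrow>
    'g \<Rightarrow> ('i \<times> 'g set) ell2 \<Rightarrow> ('i \<times> 'g set) ell2" where
  "quot_rep G I H g f = Abs_ell2 (\<lambda>(i, K). if (i, K) \<in> coset_points G I H
      then coord f (i, inv\<^bsub>G\<^esub> g <#\<^bsub>G\<^esub> K) else 0)"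

text \<open>The function under \<^const>\<open>Abs_ell2\<close> is indeed square summable:\<close>

lemma coord_quot_rep:
  assumes "group G" "\<forall>i\<in>I. subgroup (H i) G" "g \<in> carrier G"
  shows "coord (quot_rep G I H g f) (i, K) =
    (if (i, K) \<in> coset_points G I H then coord f (i, inv\<^bsub>G\<^esub> g <#\<^bsub>G\<^esub> K) else 0)"
proof -
  interpret group G by (rule assms(1))
  let ?D = "coset_points G I H" and ?T = "\<lambda>p. (fst p, inv\<^bsub>G\<^esub> g <#\<^bsub>G\<^esub> snd p)"
  have sub: "snd p \<subseteq> carrier G" if "p \<in> ?D" for p
  proof -
    have "subgroup (H (fst p)) G" and "snd p \<in> lcosets\<^bsub>G\<^esub> (H (fst p))"
      using that assms(2) unfolding coset_points_def by force+
    then show ?thesis using subgroup.lcosets_carrier assms(1) by blast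
  qed
  have inv: "g <#\<^bsub>G\<^esub> (inv\<^bsub>G\<^esub> g <#\<^bsub>G\<^esub> snd p) = snd p" if "p \<in> ?D" for p
    using lcos_m_assoc[OF sub[OF that] assms(3) inv_closed[OF assms(3)]] lcos_mult_one[OF sub[OF that]]
      r_inv[OF assms(3)] by simp
  have "inj_on ?T ?D"
  proof (rule inj_onI)
    fix p q assume "p \<in> ?D" "q \<in> ?D" "?T p = ?T q"
    then show "p = q" using inv[of p] inv[of q] by (metis prod_eq_iff fst_conv snd_conv)
  qed
  moreover have "(\<lambda>p. (coord f p)\<^sup>2) summable_on ?T ` ?D"
    by (rule summable_on_subset_banach[of _ UNIV]) (use coord[of f] in simp_all)
  ultimately have "(\<lambda>p. (coord f (?T p))\<^sup>2) summable_on ?D"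
    using summable_on_reindex[of ?T ?D "\<lambda>p. (coord f p)\<^sup>2"] by (simp add: o_def)
  moreover have "(\<lambda>p. (if p \<in> ?D then coord f (?T p) else 0)\<^sup>2) summable_on UNIV \<longleftrightarrow>
      (\<lambda>p. (coord f (?T p))\<^sup>2) summable_on ?D"
    by (rule summable_on_cong_neutral) auto
  ultimately have "(\<lambda>p. (if p \<in> ?D then coord f (?T p) else 0)\<^sup>2) summable_on UNIV"
    by blast
  then show ?thesis
    unfolding quot_rep_def by (simp add: Abs_ell2_inverse case_prod_unfold)
qed

definition rep_conv :: "('g, 'm) monoid_scheme \<Rightarrow> 'i set \<Rightarrow> ('i \<Rightarrow> 'g set) \<Rightarrow>
    ('g \<Rightarrow> real) \<Rightarrow> ('i \<times> 'g set) ell2 \<Rightarrow> ('i \<times> 'g set) ell2" where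
  "rep_conv G I H \<phi> f = (\<Sum>\<^sub>\<infinity>g\<in>carrier G. \<phi> g *\<^sub>R quot_rep G I H g f)"


section \<open>Densities and twisted measures\<close>

definition phi_le :: "('a \<Rightarrow> 'a \<Rightarrow> bool) \<Rightarrow> ('a word \<Rightarrow> real) \<Rightarrow> ('g, 'm) monoid_scheme \<Rightarrow> ('a \<Rightarrow> 'g) \<Rightarrow>
    'a \<Rightarrow> 'a \<Rightarrow> 'a word \<Rightarrow> (nat \<Rightarrow> real) \<Rightarrow> nat \<Rightarrow> real \<Rightarrow> 'g \<Rightarrow> real" where
  "phi_le \<tau> R G s A a x c N t g = (\<Sum>n=1..N. t powi (- int n) * c n *
      (\<Sum>w\<in>{w \<in> words \<tau> n A a. word_prod G s w = g}. birkhoff_prod R n (w \<frown> x)))"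

definition phi :: "('a \<Rightarrow> 'a \<Rightarrow> bool) \<Rightarrow> ('a word \<Rightarrow> real) \<Rightarrow> ('g, 'm) monoid_scheme \<Rightarrow> ('a \<Rightarrow> 'g) \<Rightarrow>
    'a \<Rightarrow> 'a \<Rightarrow> 'a word \<Rightarrow> (nat \<Rightarrow> real) \<Rightarrow> real \<Rightarrow> 'g \<Rightarrow> real" where
  "phi \<tau> R G s A a x c t g = lim (\<lambda>N. phi_le \<tau> R G s A a x c N t g)"

definition phi_vec :: "('a \<Rightarrow> 'a \<Rightarrow> bool) \<Rightarrow> ('a word \<Rightarrow> real) \<Rightarrow> ('g, 'm) monoid_scheme \<Rightarrow> ('a \<Rightarrow> 'g) \<Rightarrow>
    'a \<Rightarrow> 'a \<Rightarrow> 'a word \<Rightarrow> 'i set \<Rightarrow> ('i \<Rightarrow> 'g set) \<Rightarrow> ('i \<times> 'g set) ell2 \<Rightarrow>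
    (nat \<Rightarrow> real) \<Rightarrow> real \<Rightarrow> ('i \<times> 'g set) ell2" where
  "phi_vec \<tau> R G s A a x I H f c t = rep_conv G I H (phi \<tau> R G s A a x c t) f"

text \<open>\<open>\<parallel>\<phi>\<^sub>c[t] * f\<parallel> < \<infinity>\<close>: the series defining \<open>\<phi>\<^sub>c[t]\<close>, and then the one defining the vector
  \<open>\<phi>\<^sub>c[t] * f\<close>, converge. All terms are non-negative if \<open>f\<close> lies in the cone.\<close>

definition phi_vec_finite :: "('a \<Rightarrow> 'a \<Rightarrow> bool) \<Rightarrow> ('a word \<Rightarrow> real) \<Rightarrow> ('g, 'm) monoid_scheme \<Rightarrow>
    ('a \<Rightarrow> 'g) \<Rightarrow> 'a \<Rightarrow> 'a \<Rightarrow> 'a word \<Rightarrow> 'i set \<Rightarrow> ('i \<Rightarrow> 'g set) \<Rightarrow> ('i \<times> 'g set) ell2 \<Rightarrow>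
    (nat \<Rightarrow> real) \<Rightarrow> real \<Rightarrow> bool" where
  "phi_vec_finite \<tau> R G s A a x I H f c t \<longleftrightarrow>
    (\<forall>g\<in>carrier G. convergent (\<lambda>N. phi_le \<tau> R G s A a x c N t g)) \<and>
    (\<lambda>g. phi \<tau> R G s A a x c t g *\<^sub>R quot_rep G I H g f) summable_on carrier G"

definition gamma_exponent :: "('a \<Rightarrow> 'a \<Rightarrow> bool) \<Rightarrow> ('a word \<Rightarrow> real) \<Rightarrow> ('g, 'm) monoid_scheme \<Rightarrow>
    ('a \<Rightarrow> 'g) \<Rightarrow> 'a \<Rightarrow> 'a \<Rightarrow> 'a word \<Rightarrow> 'i set \<Rightarrow> ('i \<Rightarrow> 'g set) \<Rightarrow> ('i \<times> 'g set) ell2 \<Rightarrow> real" where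
  "gamma_exponent \<tau> R G s A a x I H f = Inf {t. t > 0 \<and>
      bdd_above (range (\<lambda>N. norm (rep_conv G I H (phi_le \<tau> R G s A a x (\<lambda>_. 1) N t) f)))}"

definition slowly_increasing :: "(nat \<Rightarrow> real) \<Rightarrow> bool" where
  "slowly_increasing c \<longleftrightarrow> (\<forall>n. c n > 0) \<and> mono c \<and> (\<lambda>n. c (Suc n) / c n) \<longlonglongrightarrow> 1"

text \<open>The weighted sum of the Dirac masses at the points \<open>vx\<close>, as the image of a weighted counting
  measure on the set of words \<open>v\<close> (a disjoint union over the first letter and the length).\<close>

definition twisted_sum :: "('a \<Rightarrow> 'a \<Rightarrow> bool) \<Rightarrow> ('a word \<Rightarrow> real) \<Rightarrow> ('g, 'm) monoid_scheme \<Rightarrow>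
    ('a \<Rightarrow> 'g) \<Rightarrow> 'a \<Rightarrow> 'a \<Rightarrow> 'a word \<Rightarrow> 'i set \<Rightarrow> ('i \<Rightarrow> 'g set) \<Rightarrow> ('i \<times> 'g set) ell2 \<Rightarrow>
    (nat \<Rightarrow> real) \<Rightarrow> real \<Rightarrow> 'a word measure" where
  "twisted_sum \<tau> R G s A a x I H f c t =
    distr
      (density (count_space (\<Union>B. \<Union>n\<in>{1..}. words \<tau> n B a))
        (\<lambda>v. ennreal (t powi (- int (length v)) * c (length v) * birkhoff_prod R (length v) (v \<frown> x) *
          (inner (quot_rep G I H (word_prod G s v) f) (phi_vec \<tau> R G s A a x I H f c t) /
           (norm (phi_vec \<tau> R G s A a x I H f c t))\<^sup>2))))
      (shift_borel \<tau>) (\<lambda>v. v \<frown> x)"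

end

theory Submission
  imports Defs
begin

text \<open>
Both claims rest on one estimate: there is a constant \<open>C\<close> such that for every word \<open>w\<close> of
length \<open>n\<close> and every point \<open>z\<close> that starts with \<open>w\<close>, the cylinder \<open>[w]\<close> satisfies
\<open>\<nu>[w] \<le> C \<gamma>\<^sup>-\<^sup>n R\<^sub>n(z) \<Upsilon>(s(w))\<close> (lemma \<open>cylinder_bound\<close>). Here \<open>\<Phi> t\<close> is the vector
\<open>\<phi>\<^sub>c[t] * f\<close> and \<open>s(w)\<close> is the group product along \<open>w\<close>.

To see it, fix \<open>t > \<gamma>\<close> and look at the words \<open>v\<close> whose Dirac masses contribute to \<open>[w]\<close>. There are
finitely many short ones, and by Cauchy-Schwarz each of them carries a mass of order
\<open>1 / \<parallel>\<Phi> t\<parallel>\<close>, which tends to zero. A long one is \<open>v = wu\<close> with \<open>u\<close> long. Its Birkhoff product splits,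
\<open>R\<^sub>n\<close> may be evaluated at \<open>z\<close> at the cost of a distortion constant, and \<open>c\<close> grows so slowly that it
at most doubles between \<open>|u|\<close> and \<open>n + |u|\<close>. Apart from the factor \<open>t\<^sup>-\<^sup>n R\<^sub>n(z)\<close>, what remains is
a sum over \<open>u\<close> of terms like those of \<open>\<phi>\<^sub>c[t]\<close>, translated by \<open>s(w)\<close>. By transitivity, \<open>u\<close> can be
prolonged on both sides, by finitely many fixed connecting words with trivial group product, to one of the words that define \<open>\<phi>\<^sub>c[t]\<close>. Hence this sum is at most a
constant times \<open>\<langle>\<rho>(s(w)) \<Phi> t, \<Phi> t\<rangle> / \<parallel>\<Phi> t\<parallel>\<^sup>2\<close> (lemmas \<open>bridge_weight\<close>, \<open>bridge_sum\<close> and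
\<open>sum_words_le_inner\<close>), which converges to \<open>\<Upsilon>(s(w))\<close> along the sequence \<open>tk\<close>. Since cylinders are
clopen, their masses pass to the weak limit. All vectors involved lie in the positive cone, so it is
enough to compare finite partial sums coordinate by coordinate; no series has to be rearranged.

The set of points \<open>z\<close> with \<open>\<Upsilon>(s(w)) < b\<^sub>n(s(w))\<close> for their prefix \<open>w\<close> of length \<open>n\<close> is a union of
cylinders, of total mass at most \<open>C \<gamma>\<^sup>-\<^sup>n \<Sum>\<^sub>w R\<^sub>n b\<^sub>n(s(w))\<close>. By the Borel-Cantelli lemma it
suffices that these numbers are summable over \<open>n\<close> (lemma \<open>AE_Upsilon_ge\<close>):

\<^item> for \<open>b\<^sub>n = n\<^sup>-\<^sup>2 \<gamma>\<^sup>n\<close>, because \<open>\<Sum>\<^sub>w R\<^sub>n\<close> is bounded in \<open>n\<close>: up to a constant, the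
  sums over loops are supermultiplicative, so that an exceptionally large one would make the
  sums over periodic points grow exponentially, against the vanishing pressure
  (lemmas \<open>loop_sum_bounded\<close> and \<open>prefix_sum_bounded\<close>);

\<^item> for \<open>b\<^sub>n(g) = (1 - \<epsilon>)\<^sup>n \<langle>\<rho>(g) f, v\<rangle>\<close>, because the series over \<open>n\<close> is then, with
  \<open>t = \<gamma> / (1 - \<epsilon>) > \<gamma>\<close>, a sum of the same kind as above and is dominated by
  \<open>\<langle>\<Phi> t, v\<rangle> < \<infinity>\<close>.

Division by powers of \<open>\<gamma>\<close> is legitimate because a single loop with trivial group product already
makes \<open>\<phi>\<^sub>c[t]\<close> diverge at the identity for small \<open>t\<close> (lemma \<open>gamma_pos\<close>).
\<close>

section \<open>Coordinatewise order and quotient representations\<close>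

lemma coord_ext: "(\<And>p. coord f p = coord g p) \<Longrightarrow> f = g"
  by (simp add: coord_inject[symmetric] fun_eq_iff)

lemma bounded_linear_coord: "bounded_linear (\<lambda>f. coord f p)"
proof (rule bounded_linear_intro[where K = 1])
  show "norm (coord f p) \<le> norm f * 1" for f
    using ell2_sum_le_norm[of "{p}" f] abs_le_square_iff[of "coord f p" "norm f"] by simp
qed (simp_all add: plus_ell2.rep_eq scaleR_ell2.rep_eq)

lemma coord_sum: "coord (\<Sum>j\<in>F. u j) p = (\<Sum>j\<in>F. coord (u j) p)"
  using linear_sum[OF bounded_linear.linear[OF bounded_linear_coord]] .

lemma coord_scaleR: "coord (r *\<^sub>R u) p = r * coord u p"
  by (simp add: scaleR_ell2.rep_eq)

lemma inner_summable: "(\<lambda>p. coord f p * coord g p) summable_on UNIV"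
  using coord[of f] coord[of g] by (intro ell2_prod_summable) auto

lemma inner_coord_mono:
  assumes "\<And>p. coord f p \<le> coord g p" "\<And>p. 0 \<le> coord v p"
  shows "inner f v \<le> inner g v"
  unfolding inner_ell2.rep_eq
  by (intro infsum_mono inner_summable mult_right_mono assms)

lemma inner_coord_nonneg:
  assumes "\<And>p. 0 \<le> coord f p" "\<And>p. 0 \<le> coord v p"
  shows "0 \<le> inner f v"
  using inner_coord_mono[of 0 f v] assms by (simp add: zero_ell2.rep_eq)

lemma rep_cone_nonneg: "f \<in> rep_cone G I H \<Longrightarrow> 0 \<le> coord f p"
  by (cases p) (simp add: rep_cone_def)

context
  fixes G :: "('g, 'm) monoid_scheme" and I :: "'i set" and H :: "'i \<Rightarrow> 'g set"
  assumes G: "group G" and H: "\<forall>i\<in>I. subgroup (H i) G"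
begin

lemma quot_rep_nonneg:
  assumes "g \<in> carrier G" "\<And>p. 0 \<le> coord f p"
  shows "0 \<le> coord (quot_rep G I H g f) p"
  using assms coord_quot_rep[OF G H] by (cases p) auto

lemma coset_points_carrier: 
  assumes "(i, K) \<in> coset_points G I H" 
  shows "K \<subseteq> carrier G"
proof -
  have "subgroup (H i) G" and "K \<in> lcosets\<^bsub>G\<^esub> (H i)"
    using assms H unfolding coset_points_def by auto
  then show ?thesis using subgroup.lcosets_carrier G by blast
qed

lemma coset_points_translate:
  assumes "g \<in> carrier G" "(i, K) \<in> coset_points G I H" 
  shows "(i, g <#\<^bsub>G\<^esub> K) \<in> coset_points G I H"
proof -
  interpret group G by (rule G)
  have i: "i \<in> I" and "K \<in> lcosets\<^bsub>G\<^esub> (H i)" using assms unfolding coset_points_def by auto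
  then obtain h where h: "h \<in> carrier G" "K = h <#\<^bsub>G\<^esub> H i" unfolding LCOSETS_def by auto
  have "H i \<subseteq> carrier G" using H i subgroup.subset by blast
  then have "g <#\<^bsub>G\<^esub> K = (g \<otimes>\<^bsub>G\<^esub> h) <#\<^bsub>G\<^esub> H i" using h assms by (simp add: lcos_m_assoc)
  then show ?thesis using i h assms unfolding coset_points_def LCOSETS_def by auto
qed

lemma quot_rep_mult:
  assumes "g \<in> carrier G" "h \<in> carrier G"
  shows "quot_rep G I H (g \<otimes>\<^bsub>G\<^esub> h) f = quot_rep G I H g (quot_rep G I H h f)"
proof (rule coord_ext, clarify)
  fix i K
  interpret group G by (rule G)
  show "coord (quot_rep G I H (g \<otimes>\<^bsub>G\<^esub> h) f) (i, K) = coord (quot_rep G I H g (quot_rep G I H h f)) (i, K)"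
    using assms coset_points_translate[of "inv\<^bsub>G\<^esub> g" i K] coset_points_carrier[of i K]
    by (simp add: coord_quot_rep[OF G H] lcos_m_assoc inv_mult_group)
qed

lemma quot_rep_mono:
  assumes "g \<in> carrier G" "\<And>p. coord f p \<le> coord f' p"
  shows "coord (quot_rep G I H g f) p \<le> coord (quot_rep G I H g f') p"
  using assms coord_quot_rep[OF G H] by (cases p) auto

lemma quot_rep_sum:
  assumes "g \<in> carrier G"
  shows "quot_rep G I H g (\<Sum>j\<in>F. r j *\<^sub>R u j) = (\<Sum>j\<in>F. r j *\<^sub>R quot_rep G I H g (u j))"
  by (rule coord_ext, clarify)
    (simp add: coord_quot_rep[OF G H assms] coord_sum coord_scaleR)

end

section \<open>Words, cylinders and Birkhoff products\<close>

text \<open>A prefix stays a single term; the default rule would split off its last letter.\<close>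

declare subseq_to_Suc [simp del]

lemma birkhoff_prod_add:
  "birkhoff_prod R (n + m) y = birkhoff_prod R n y * birkhoff_prod R m (suffix n y)"
proof -
  have "birkhoff_prod R (n + m) y = (\<Prod>i<n. R (suffix i y)) * (\<Prod>i=n..<n+m. R (suffix i y))"
    unfolding birkhoff_prod_def by (subst prod.union_disjoint[symmetric]) (auto simp: ivl_disj_un)
  also have "(\<Prod>i=n..<n+m. R (suffix i y)) = (\<Prod>i<m. R (suffix i (suffix n y)))"
    by (rule prod.reindex_bij_witness[of _ "\<lambda>i. n + i" "\<lambda>i. i - n"]) auto
  finally show ?thesis unfolding birkhoff_prod_def .
qed

lemma shift_space_suffix: "y \<in> shift_space \<tau> \<Longrightarrow> suffix n y \<in> shift_space \<tau>"
  by (simp add: shift_space_def)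

lemma prefix_eq_iff: "prefix n y = prefix n z \<longleftrightarrow> (\<forall>i<n. y i = z i)"
  by (auto simp: list_eq_iff_nth_eq)

lemma successively_nth:
  "successively \<tau> w \<longleftrightarrow> (\<forall>i. Suc i < length w \<longrightarrow> \<tau> (w ! i) (w ! Suc i))"
proof (induction w rule: induct_list012)
  case (3 b d w)
  then show ?case by (auto simp: nth_Cons split: nat.splits)
qed auto

lemma successively_prefix: "y \<in> shift_space \<tau> \<Longrightarrow> successively \<tau> (prefix n y)"
  by (auto simp: successively_nth shift_space_def)

lemma shift_space_conc:
  assumes "successively \<tau> w" "y \<in> shift_space \<tau>" "w \<noteq> [] \<Longrightarrow> \<tau> (last w) (y 0)"
  shows "w \<frown> y \<in> shift_space \<tau>"
  unfolding shift_space_def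
proof (intro CollectI allI)
  fix i
  consider "Suc i < length w" | "Suc i = length w" | "length w \<le> i" by linarith
  then show "\<tau> ((w \<frown> y) i) ((w \<frown> y) (Suc i))"
  proof cases
    case 1 then show ?thesis using assms(1) by (simp add: successively_nth)
  next
    case 2
    then have "w \<noteq> []" by auto
    then have "last w = w ! i" using 2 by (simp add: last_conv_nth flip: 2)
    then show ?thesis using assms(3) 2 \<open>w \<noteq> []\<close> by (simp add: conc_def)
  next
    case 3 then show ?thesis using assms(2) by (simp add: conc_def shift_space_def Suc_diff_le)
  qed
qed

lemma finite_words_of_length: "finite {w :: 'a::finite list. length w = n}"
  using finite_lists_length_eq[OF finite, of UNIV n] by simp

lemma finite_prefixes: "finite (prefix n ` (S :: 'a::finite word set))"
  by (rule finite_subset[OF _ finite_words_of_length[of n]]) auto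

lemma successively_append:
  "successively \<tau> (u @ v) \<longleftrightarrow>
    successively \<tau> u \<and> successively \<tau> v \<and> (u \<noteq> [] \<longrightarrow> v \<noteq> [] \<longrightarrow> \<tau> (last u) (hd v))"
  by (auto simp: successively_append_iff)

lemma finite_words: "finite (words \<tau> n B (b :: 'a::finite))"
  by (rule finite_subset[OF _ finite_words_of_length[of n]]) (auto simp: words_def)

lemma conc_prefix: "length u = n \<Longrightarrow> prefix n (u \<frown> y) = u"
  by (metis prefix_conc_length)

lemma conc_suffix: "length u = n \<Longrightarrow> suffix n (u \<frown> y) = y"
  by (metis suffix_conc_length)

lemma word_prod_append:
  assumes "group G" "\<And>b. s b \<in> carrier G"
  shows "word_prod G s (u @ v) = word_prod G s u \<otimes>\<^bsub>G\<^esub> word_prod G s v"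
    and "word_prod G s u \<in> carrier G"
proof -
  interpret group G by (rule assms)
  have c: "word_prod G s u \<in> carrier G" for u
    by (induction u) (auto simp: word_prod_def assms)
  show "word_prod G s u \<in> carrier G" by (rule c)
  show "word_prod G s (u @ v) = word_prod G s u \<otimes>\<^bsub>G\<^esub> word_prod G s v"
  proof (induction u)
    case Nil then show ?case using c[of v] by (simp add: word_prod_def)
  next
    case (Cons b u)
    then show ?case using c[of u] c[of v] assms(2)[of b]
      by (simp add: word_prod_def m_assoc)
  qed
qed

lemma topspace_shift_top: "topspace (shift_top \<tau>) = shift_space \<tau>"
  by (simp add: shift_top_def)

lemma sigma_opens_eq:
  "sigma_sets (topspace (shift_top \<tau>)) {U. openin (shift_top \<tau>) U} = sets (shift_borel \<tau>)"
  and space_shift_borel: "space (shift_borel \<tau>) = shift_space \<tau>"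
proof -
  have "{U. openin (shift_top \<tau>) U} \<subseteq> Pow (shift_space \<tau>)"
    using openin_subset[of "shift_top \<tau>"] by (auto simp: topspace_shift_top)
  then show "sigma_sets (topspace (shift_top \<tau>)) {U. openin (shift_top \<tau>) U} = sets (shift_borel \<tau>)"
    "space (shift_borel \<tau>) = shift_space \<tau>"
    by (simp_all add: shift_borel_def topspace_shift_top sets_measure_of space_measure_of)
qed

text \<open>A condition on the first \<open>n\<close> letters defines a union of cylinders. The same applies to its
  negation, so these sets are even clopen.\<close>

lemma openin_prefix_pred: "openin (shift_top \<tau>) {y \<in> shift_space \<tau>. P (prefix n y)}"
proof -
  have cyl: "openin (product_topology (\<lambda>_. discrete_topology UNIV) UNIV) {y. prefix n y = prefix n z}"
    for z :: "'a word"
  proof -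
    have "openin (product_topology (\<lambda>_. discrete_topology UNIV) UNIV)
        (\<Pi>\<^sub>E i\<in>UNIV. if i < n then {z i} else UNIV)"
      by (rule product_topology_basis) (auto intro: finite_subset[of _ "{..<n}"])
    moreover have "(\<Pi>\<^sub>E i\<in>UNIV. if i < n then {z i} else UNIV) = {y. prefix n y = prefix n z}"
      unfolding prefix_eq_iff by (auto simp: PiE_iff split: if_splits)
    ultimately show ?thesis by simp
  qed
  let ?U = "\<Union>z\<in>{z. P (prefix n z)}. {y. prefix n y = prefix n z}"
  have "{y \<in> shift_space \<tau>. P (prefix n y)} = ?U \<inter> shift_space \<tau>"
    by auto
  moreover have "openin (product_topology (\<lambda>_. discrete_topology UNIV) UNIV) ?U"
    by (rule openin_Union) (auto simp del: prefix_eq_iff intro: cyl)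
  ultimately show ?thesis
    unfolding shift_top_def openin_subtopology by (intro exI[of _ ?U] conjI)
qed

lemma sets_prefix_pred: "{y \<in> shift_space \<tau>. P (prefix n y)} \<in> sets (shift_borel \<tau>)"
  unfolding sigma_opens_eq[symmetric] by (rule sigma_sets.Basic) (simp add: openin_prefix_pred)

text \<open>The indicator of a clopen set is a continuous test function.\<close>

lemma weak_star_limit_prefix_pred:
  assumes "weak_star_limit (shift_top \<tau>) Ms M"
  shows "(\<lambda>k. measure (Ms k) {y \<in> shift_space \<tau>. P (prefix n y)})
    \<longlonglongrightarrow> measure M {y \<in> shift_space \<tau>. P (prefix n y)}"
proof -
  let ?D = "{y \<in> shift_space \<tau>. P (prefix n y)}"
  have "continuous_map (shift_top \<tau>) euclideanreal (indicator ?D)"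
    unfolding continuous_map
  proof (intro conjI allI impI)
    fix U :: "real set"
    have "{y \<in> topspace (shift_top \<tau>). indicator ?D y \<in> U} =
        {y \<in> shift_space \<tau>. (if P (prefix n y) then 1 else 0) \<in> U}"
      by (auto simp: topspace_shift_top indicator_def)
    then show "openin (shift_top \<tau>) {y \<in> topspace (shift_top \<tau>). indicator ?D y \<in> U}"
      using openin_prefix_pred[where P = "\<lambda>w. (if P w then 1 else 0) \<in> U" and n = n] by simp
  qed auto
  then have "(\<lambda>k. integral\<^sup>L (Ms k) (indicator ?D :: _ \<Rightarrow> real)) \<longlonglongrightarrow> integral\<^sup>L M (indicator ?D)"
    using assms unfolding weak_star_limit_def by blast
  moreover have "space (Ms k) = shift_space \<tau>" "space M = shift_space \<tau>" for k
  proof -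
    have "sets (Ms k) = sets (shift_borel \<tau>)" "sets M = sets (shift_borel \<tau>)"
      using assms unfolding weak_star_limit_def sigma_opens_eq by auto
    then show "space (Ms k) = shift_space \<tau>" "space M = shift_space \<tau>"
      using space_shift_borel by (metis sets_eq_imp_space_eq)+
  qed
  moreover have "?D \<inter> shift_space \<tau> = ?D" by auto
  ultimately show ?thesis by simp
qed

section \<open>Bounded distortion\<close>

locale weighted_shift =
  fixes \<tau> :: "'a::finite \<Rightarrow> 'a \<Rightarrow> bool" and R :: "'a word \<Rightarrow> real"
  assumes R_pos: "y \<in> shift_space \<tau> \<Longrightarrow> R y > 0"
    and R_log_regular: "log_regular \<tau> R"
    and shift_nonempty: "shift_space \<tau> \<noteq> {}"
begin

abbreviation "X \<equiv> shift_space \<tau>"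

lemma regularity_constants:
  obtains C \<theta> where "C > 0" "0 \<le> \<theta>" "\<theta> < 1"
    "\<And>y z n. \<lbrakk>y \<in> X; z \<in> X; n \<ge> 2; prefix n y = prefix n z\<rbrakk> \<Longrightarrow> \<bar>ln (R y) - ln (R z)\<bar> \<le> C * \<theta> ^ n"
proof -
  obtain C \<theta> where C: "C > 0" "\<theta> < 1"
    "\<And>y z n. \<lbrakk>y \<in> X; z \<in> X; n \<ge> 2; prefix n y = prefix n z\<rbrakk> \<Longrightarrow> \<bar>ln (R y) - ln (R z)\<bar> \<le> C * \<theta> ^ n"
    using R_log_regular unfolding log_regular_def by blast
  obtain y where "y \<in> X" using shift_nonempty by auto
  \<comment> \<open>comparing a point with itself at an odd length rules out a negative ratio\<close>
  then have "0 \<le> C * \<theta> ^ 3" using C(3)[of y y 3] by simp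
  then have "0 \<le> \<theta>" using C(1) by (simp add: zero_le_mult_iff zero_le_power_eq)
  then show thesis using C that by blast
qed

text \<open>Regularity bounds the oscillation of \<open>ln R\<close> on each of the finitely many cylinders of
  length two.\<close>

lemma ln_R_bounded: obtains L where "L \<ge> 0" "\<And>y. y \<in> X \<Longrightarrow> \<bar>ln (R y)\<bar> \<le> L"
proof -
  obtain C \<theta> where C: "C > 0" "0 \<le> \<theta>" "\<theta> < 1"
    "\<And>y z n. \<lbrakk>y \<in> X; z \<in> X; n \<ge> 2; prefix n y = prefix n z\<rbrakk> \<Longrightarrow> \<bar>ln (R y) - ln (R z)\<bar> \<le> C * \<theta> ^ n"
    using regularity_constants by blast
  define r where "r w = (SOME y. y \<in> X \<and> prefix 2 y = w)" for w
  have r: "r (prefix 2 y) \<in> X \<and> prefix 2 (r (prefix 2 y)) = prefix 2 y" if "y \<in> X" for y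
    unfolding r_def by (rule someI[of _ y]) (use that in auto)
  define P where "P = (\<lambda>w. \<bar>ln (R (r w))\<bar>) ` prefix 2 ` X"
  have fin: "finite P" unfolding P_def by (intro finite_imageI finite_prefixes)
  have "\<bar>ln (R y)\<bar> \<le> C + Max P" if "y \<in> X" for y
  proof -
    have "\<bar>ln (R (r (prefix 2 y)))\<bar> \<le> Max P"
      by (rule Max_ge[OF fin]) (auto simp: P_def that)
    moreover have "\<bar>ln (R y) - ln (R (r (prefix 2 y)))\<bar> \<le> C * \<theta> ^ 2"
      using C(4)[of y "r (prefix 2 y)" 2] r[OF that] that by auto
    moreover have "C * \<theta> ^ 2 \<le> C" using C by (simp add: power_le_one)
    ultimately show ?thesis by linarith
  qed
  moreover obtain y where "y \<in> X" using shift_nonempty by auto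
  ultimately show thesis using that[of "C + Max P"] abs_ge_zero order_trans by blast
qed

definition L where "L = (SOME L. L \<ge> 0 \<and> (\<forall>y\<in>X. \<bar>ln (R y)\<bar> \<le> L))"

lemma L_spec: "L \<ge> 0 \<and> (\<forall>y\<in>X. \<bar>ln (R y)\<bar> \<le> L)"
  unfolding L_def by (rule someI_ex, rule ln_R_bounded) blast

lemmas L_nonneg = L_spec[THEN conjunct1]
  and L_bound = L_spec[THEN conjunct2, rule_format]

lemma birkhoff_pos: "y \<in> X \<Longrightarrow> birkhoff_prod R n y > 0"
  unfolding birkhoff_prod_def by (intro prod_pos) (auto intro: R_pos shift_space_suffix)

lemma birkhoff_lower:
  assumes "y \<in> X" shows "exp (- L) ^ n \<le> birkhoff_prod R n y"
proof -
  have "exp (- L) \<le> R (suffix i y)" for i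
  proof -
    have s: "suffix i y \<in> X" using assms by (rule shift_space_suffix)
    have "exp (- L) \<le> exp (ln (R (suffix i y)))" using L_bound[OF s] by simp
    then show ?thesis using R_pos[OF s] by simp
  qed
  then have "(\<Prod>i<n. exp (- L)) \<le> birkhoff_prod R n y"
    unfolding birkhoff_prod_def by (intro prod_mono) auto
  then show ?thesis by simp
qed

lemma ln_birkhoff:
  assumes "y \<in> X"
  shows "ln (birkhoff_prod R n y) = (\<Sum>i<n. ln (R (suffix i y)))"
proof -
  have "R (suffix i y) \<noteq> 0" for i
    using R_pos[OF shift_space_suffix[OF assms, of i]] by simp
  then show ?thesis unfolding birkhoff_prod_def by (intro ln_prod) auto
qed

text \<open>The oscillations along the orbit form a geometric series. The last factor needs a separate
  argument: there the two points share just one letter, which is too few for the regularity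
  condition, and the uniform bound on \<open>ln R\<close> is used.\<close>

lemma distortion_ex:
  "\<exists>K\<ge>1. \<forall>n. \<forall>y\<in>X. \<forall>z\<in>X. prefix n y = prefix n z \<longrightarrow> birkhoff_prod R n y \<le> K * birkhoff_prod R n z"
proof -
  obtain C \<theta> where C: "C > 0" "0 \<le> \<theta>" "\<theta> < 1"
    "\<And>y z n. \<lbrakk>y \<in> X; z \<in> X; n \<ge> 2; prefix n y = prefix n z\<rbrakk> \<Longrightarrow> \<bar>ln (R y) - ln (R z)\<bar> \<le> C * \<theta> ^ n"
    using regularity_constants by blast
  define M where "M = 2 * L + C / (1 - \<theta>)"
  have M0: "M \<ge> 0" using C L_nonneg by (simp add: M_def)
  have main: "birkhoff_prod R n y \<le> exp M * birkhoff_prod R n z"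
    if y: "y \<in> X" and z: "z \<in> X" and eq: "prefix n y = prefix n z" for n y z
  proof (cases n)
    case 0 then show ?thesis using M0 by (simp add: birkhoff_prod_def)
  next
    case (Suc m)
    let ?d = "\<lambda>i. ln (R (suffix i y)) - ln (R (suffix i z))"
    have s: "suffix i y \<in> X" "suffix i z \<in> X" for i using y z by (auto intro: shift_space_suffix)
    have "\<bar>?d i\<bar> \<le> C * \<theta> ^ (m - Suc i)" if "i < m" for i
    proof -
      have "prefix (n - i) (suffix i y) = prefix (n - i) (suffix i z)"
        using eq by (simp only: prefix_eq_iff) (use that Suc in auto)
      then have "\<bar>?d i\<bar> \<le> C * \<theta> ^ (n - i)" using C(4)[OF s] that Suc by simp
      also have "\<dots> \<le> C * \<theta> ^ (m - Suc i)"
        using C Suc by (intro mult_left_mono power_decreasing) auto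
      finally show ?thesis .
    qed
    then have "(\<Sum>i<m. ?d i) \<le> (\<Sum>i<m. C * \<theta> ^ (m - Suc i))"
      by (intro sum_mono) (force dest: abs_le_D1)
    also have "\<dots> = C * (\<Sum>i<m. \<theta> ^ i)"
      using sum.nat_diff_reindex[of "\<lambda>i. C * \<theta> ^ i" m] by (simp add: sum_distrib_left)
    also have "\<dots> \<le> C * (1 / (1 - \<theta>))"
    proof -
      have "(\<Sum>i<m. \<theta> ^ i) = (1 - \<theta> ^ m) / (1 - \<theta>)" using C sum_gp_strict[of \<theta> m] by simp
      also have "\<dots> \<le> 1 / (1 - \<theta>)" using C by (intro divide_right_mono) auto
      finally show ?thesis using C by (intro mult_left_mono) auto
    qed
    finally have "(\<Sum>i<m. ?d i) \<le> C / (1 - \<theta>)" by simp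
    moreover have "?d m \<le> 2 * L" using L_bound[OF s(1)[of m]] L_bound[OF s(2)[of m]] by linarith
    ultimately have "(\<Sum>i<n. ?d i) \<le> M" unfolding M_def Suc by simp
    then have "ln (birkhoff_prod R n y) \<le> M + ln (birkhoff_prod R n z)"
      by (simp add: ln_birkhoff y z sum_subtractf)
    then have "exp (ln (birkhoff_prod R n y)) \<le> exp (M + ln (birkhoff_prod R n z))" by simp
    then show ?thesis using birkhoff_pos y z by (simp add: exp_add)
  qed
  show ?thesis using main M0 by (intro exI[of _ "exp M"]) auto
qed

definition K where "K = (SOME K. K \<ge> 1 \<and> (\<forall>n. \<forall>y\<in>X. \<forall>z\<in>X.
  prefix n y = prefix n z \<longrightarrow> birkhoff_prod R n y \<le> K * birkhoff_prod R n z))"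

lemma K_spec: "K \<ge> 1 \<and> (\<forall>n. \<forall>y\<in>X. \<forall>z\<in>X. 
      prefix n y = prefix n z \<longrightarrow> birkhoff_prod R n y \<le> K * birkhoff_prod R n z)"
  unfolding K_def using distortion_ex by (rule someI_ex)

lemmas K_ge_1 = K_spec[THEN conjunct1]
  and distortion = K_spec[THEN conjunct2, rule_format]

lemma K_pos: "K > 0"
  using K_ge_1 by simp

end

section \<open>Bridging words to loops\<close>

locale transitive_walk = weighted_shift \<tau> R + group G
  for \<tau> :: "'a::finite \<Rightarrow> 'a \<Rightarrow> bool" and R :: "'a word \<Rightarrow> real"
    and G :: "('g, 'm) monoid_scheme" (structure) +
  fixes s :: "'a \<Rightarrow> 'g" and A a :: 'a and x :: "'a word"
  assumes s_carrier: "s b \<in> carrier G"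
    and transitive: "transitive_extension \<tau> G s"
    and aA: "\<tau> a A"
    and x_mem: "x \<in> shift_space \<tau>"
    and x_0: "x 0 = A"
begin

abbreviation "sp \<equiv> word_prod G s"

lemma sp_append: "sp (u @ v) = sp u \<otimes> sp v"
  by (rule word_prod_append(1)[OF is_group s_carrier])

lemma sp_carrier: "sp u \<in> carrier G"
  by (rule word_prod_append(2)[OF is_group s_carrier])

text \<open>The value \<open>R\<^sub>n(wx)\<close>, of interest for words that end in \<open>a\<close> and may therefore be followed by
  \<open>x\<close>.\<close>

definition "weight w = birkhoff_prod R (length w) (w \<frown> x)"

lemma words_conc:
  assumes "w \<in> words \<tau> n B a" shows "w \<frown> x \<in> X"
  by (rule shift_space_conc) (use assms aA x_mem x_0 in \<open>auto simp: words_def\<close>)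

lemma weight_pos: "w \<in> words \<tau> n B a \<Longrightarrow> weight w > 0"
  unfolding weight_def by (intro birkhoff_pos words_conc)

lemma left_connector_ex:
  "\<exists>p. p \<noteq> [] \<and> successively \<tau> p \<and> hd p = A \<and> \<tau> (last p) B \<and> sp p = \<one>"
proof -
  obtain n y where n: "n \<ge> 1" "y \<in> X" "y 0 = A" "y n = B" "sp (prefix n y) = \<one>"
    using transitive one_closed unfolding transitive_extension_def by meson
  have "hd (prefix n y) = A" "last (prefix n y) = y (n - 1)"
    using n by (auto simp: hd_conv_nth last_conv_nth)
  moreover have "\<tau> (y (n - 1)) (y n)" using n unfolding shift_space_def by (cases n) auto
  ultimately show ?thesis
    using n successively_prefix[OF n(2)] by (intro exI[of _ "prefix n y"]) auto
qed

text \<open>A path from \<open>b\<close> to \<open>a\<close> with product \<open>s(b) s(a)\<^sup>-\<^sup>1\<close> has product \<open>1\<close> after its first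
  letter is dropped and the final \<open>a\<close> is included.\<close>

lemma right_connector_ex:
  "\<exists>q. q \<noteq> [] \<and> successively \<tau> q \<and> \<tau> b (hd q) \<and> last q = a \<and> sp q = \<one>"
proof -
  have "s b \<otimes> inv (s a) \<in> carrier G" by (simp add: s_carrier)
  then obtain n y where n: "n \<ge> 1" "y \<in> X" "y 0 = b" "y n = a" "sp (prefix n y) = s b \<otimes> inv (s a)"
    using transitive unfolding transitive_extension_def by meson
  let ?q = "prefix n (suffix 1 y)"
  have "prefix (Suc n) y = [b] @ ?q"
    using subsequence_append[of y 1 n] n by simp
  moreover have "prefix (Suc n) y = prefix n y @ [a]" using n by (simp add: subseq_to_Suc)
  ultimately have "[b] @ ?q = prefix n y @ [a]" by (rule trans[OF sym])
  then have "sp ([b] @ ?q) = sp (prefix n y @ [a])" by (rule arg_cong)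
  then have "sp [b] \<otimes> sp ?q = sp (prefix n y) \<otimes> sp [a]" by (simp only: sp_append)
  then have "s b \<otimes> sp ?q = s b \<otimes> inv (s a) \<otimes> s a"
    using n by (simp add: word_prod_def s_carrier)
  then have "s b \<otimes> sp ?q = s b \<otimes> \<one>"
    by (simp add: m_assoc s_carrier)
  then have "sp ?q = \<one>" 
    using Units_l_cancel[of "s b" "sp ?q" \<one>] s_carrier sp_carrier by simp
  moreover have "hd ?q = y 1" "last ?q = y n" using n 
    by (simp_all add: hd_conv_nth last_conv_nth del: subsequence_shift)
  moreover have "\<tau> b (y 1)" using n unfolding shift_space_def by auto
  ultimately show ?thesis
    using n successively_prefix[OF shift_space_suffix[OF n(2)], where n = n]
    by (intro exI[of _ ?q]) (auto simp del: subsequence_shift)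
qed

definition "left_conn B = (SOME p. p \<noteq> [] \<and> successively \<tau> p \<and> hd p = A \<and> \<tau> (last p) B \<and> sp p = \<one>)"
definition "right_conn b = (SOME q. q \<noteq> [] \<and> successively \<tau> q \<and> \<tau> b (hd q) \<and> last q = a \<and> sp q = \<one>)"
text \<open>Bridging turns an admissible word into one that leads from \<open>A\<close> to \<open>a\<close> and has the same group
  product; \<open>slack\<close> bounds the number of letters it adds.\<close>

definition "bridge u = left_conn (hd u) @ u @ right_conn (last u)"
definition "slack = (\<Sum>B\<in>UNIV. length (left_conn B)) + (\<Sum>b\<in>UNIV. length (right_conn b))"

lemma left_conn: "left_conn B \<noteq> []" "successively \<tau> (left_conn B)" "hd (left_conn B) = A"
    "\<tau> (last (left_conn B)) B" "sp (left_conn B) = \<one>"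
  using someI_ex[OF left_connector_ex, of B] unfolding left_conn_def by auto

lemma right_conn: "right_conn b \<noteq> []" "successively \<tau> (right_conn b)" "\<tau> b (hd (right_conn b))"
    "last (right_conn b) = a" "sp (right_conn b) = \<one>"
  using someI_ex[OF right_connector_ex, of b] unfolding right_conn_def by auto

lemma conn_slack: "length (left_conn B) + length (right_conn b) \<le> slack"
  unfolding slack_def by (intro add_mono member_le_sum) auto

lemma bridge_words:
  assumes "u \<noteq> []" "successively \<tau> u"
  shows "bridge u \<in> words \<tau> (length (bridge u)) A a"
  using assms left_conn right_conn by (auto simp: words_def bridge_def successively_append)

lemma bridge_length: "length u \<le> length (bridge u)" "length (bridge u) \<le> length u + slack"
  using conn_slack[of "hd u" "last u"] by (auto simp: bridge_def)

lemma sp_bridge: "sp (bridge u) = sp u"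
  by (simp add: bridge_def sp_append left_conn right_conn sp_carrier)

text \<open>Along \<open>u\<close> the two points agree, which costs the distortion constant \<open>K\<close>; each added letter
  contributes a factor of at least \<open>exp (- L)\<close>.\<close>

lemma bridge_weight:
  assumes "u \<noteq> []" "y \<in> X" "prefix (length u) y = u"
  shows "birkhoff_prod R (length u) y \<le> K * exp L ^ slack * weight (bridge u)"
proof -
  let ?p = "left_conn (hd u)" and ?q = "right_conn (last u)"
  have sc: "successively \<tau> u" using successively_prefix[OF assms(2), of "length u"] assms(3) by simp
  have w: "bridge u \<frown> x \<in> X" using words_conc[OF bridge_words[OF assms(1) sc]] .
  then have uq: "(u @ ?q) \<frown> x \<in> X" and q: "?q \<frown> x \<in> X"
    using shift_space_suffix[OF w, of "length ?p"] shift_space_suffix[OF w, of "length ?p + length u"]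
    by (simp_all add: bridge_def)
  have "weight (bridge u) = birkhoff_prod R (length ?p + (length u + length ?q)) (bridge u \<frown> x)"
    by (simp add: weight_def bridge_def)
  also have "\<dots> = birkhoff_prod R (length ?p) (bridge u \<frown> x) *
      (birkhoff_prod R (length u) ((u @ ?q) \<frown> x) * birkhoff_prod R (length ?q) (?q \<frown> x))"
    by (simp only: birkhoff_prod_add) (simp add: bridge_def)
  finally have eq: "weight (bridge u) = \<dots>" .
  have "exp L ^ slack * (exp (- L) ^ length ?p * exp (- L) ^ length ?q)
      = exp L ^ (slack - (length ?p + length ?q))"
    using conn_slack[of "hd u" "last u"]
    by (simp add: exp_of_nat_mult[symmetric] exp_add[symmetric] of_nat_diff algebra_simps)
  also have "\<dots> \<ge> 1" using L_nonneg by simp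
  finally have ge: "1 \<le> exp L ^ slack * (exp (- L) ^ length ?p * exp (- L) ^ length ?q)" .
  have pos: "birkhoff_prod R (length u) ((u @ ?q) \<frown> x) > 0" by (rule birkhoff_pos[OF uq])
  have "birkhoff_prod R (length u) y \<le> K * birkhoff_prod R (length u) ((u @ ?q) \<frown> x)"
    by (rule distortion) (use assms uq in auto)
  also have "\<dots> \<le> K * (birkhoff_prod R (length u) ((u @ ?q) \<frown> x) *
      (exp L ^ slack * (exp (- L) ^ length ?p * exp (- L) ^ length ?q)))"
    using mult_left_mono[OF ge less_imp_le[OF pos]] K_pos by (intro mult_left_mono) auto
  also have "\<dots> \<le> K * (birkhoff_prod R (length u) ((u @ ?q) \<frown> x) *
      (exp L ^ slack * (birkhoff_prod R (length ?p) (bridge u \<frown> x) * birkhoff_prod R (length ?q) (?q \<frown> x))))"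
    using K_pos pos birkhoff_pos[OF w, of "length ?p"]
    by (intro mult_left_mono mult_mono birkhoff_lower w q) auto
  also have "\<dots> = K * exp L ^ slack * weight (bridge u)" by (simp add: eq)
  finally show ?thesis .
qed

text \<open>A bridged word determines \<open>u\<close> as soon as the first and the last letter of \<open>u\<close> are known, so
  bridging is at most \<open>CARD('a)\<^sup>2\<close> to one.\<close>

lemma bridge_sum:
  assumes F: "finite F" and h: "\<And>w. w \<in> bridge ` F \<Longrightarrow> 0 \<le> h w"
  shows "(\<Sum>u\<in>F. h (bridge u)) \<le> real (CARD('a) ^ 2) * (\<Sum>w\<in>bridge ` F. (h w :: real))"
proof -
  let ?C = "\<lambda>(B, b). {u \<in> F. hd u = B \<and> last u = b}"
  have "(\<Sum>u\<in>F. h (bridge u)) = (\<Sum>k\<in>UNIV. \<Sum>u\<in>?C k. h (bridge u))"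
    using sum.group[of F UNIV "\<lambda>u. (hd u, last u)" "\<lambda>u. h (bridge u)"] F
    by (simp add: case_prod_unfold prod_eq_iff)
  also have "\<dots> \<le> (\<Sum>k::'a \<times> 'a\<in>UNIV. \<Sum>w\<in>bridge ` F. h w)"
  proof (rule sum_mono)
    fix k :: "'a \<times> 'a"
    have "inj_on bridge (?C k)"
      by (rule inj_onI) (auto simp: bridge_def split: prod.splits)
    then have "(\<Sum>u\<in>?C k. h (bridge u)) = (\<Sum>w\<in>bridge ` ?C k. h w)"
      by (simp add: sum.reindex)
    also have "\<dots> \<le> (\<Sum>w\<in>bridge ` F. h w)"
      using F h by (intro sum_mono2) (auto split: prod.splits)
    finally show "(\<Sum>u\<in>?C k. h (bridge u)) \<le> (\<Sum>w\<in>bridge ` F. h w)" .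
  qed
  finally show ?thesis by (simp add: power2_eq_square)
qed

section \<open>Zero pressure bounds the partition sums\<close>

definition "loop_sum n = (\<Sum>w\<in>words \<tau> n A a. weight w)"

lemma loop_sum_nonneg: "0 \<le> loop_sum n"
  unfolding loop_sum_def by (intro sum_nonneg less_imp_le weight_pos)

lemma weight_append:
  "weight (u @ v) = birkhoff_prod R (length u) (u \<frown> v \<frown> x) * weight v"
  by (simp add: weight_def birkhoff_prod_add)

text \<open>Loops may be concatenated, as \<open>aA\<close> is admissible, and the two factors can be recovered from
  the result. Changing the point behind the first factor costs \<open>K\<close>.\<close>

lemma loop_sum_mult: "loop_sum n * loop_sum m \<le> K * loop_sum (n + m)"
proof -
  let ?U = "words \<tau> n A a" and ?V = "words \<tau> m A a"
  have app: "u @ v \<in> words \<tau> (n + m) A a" if "u \<in> ?U" "v \<in> ?V" for u v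
    using that aA by (auto simp: words_def successively_append)
  have le: "weight u * weight v \<le> K * weight (u @ v)" if "u \<in> ?U" "v \<in> ?V" for u v
  proof -
    have "(u @ v) \<frown> x \<in> X" by (rule words_conc[OF app[OF that]])
    then have "weight u \<le> K * birkhoff_prod R (length u) (u \<frown> v \<frown> x)"
      unfolding weight_def using words_conc[OF that(1)] by (intro distortion) auto
    then have "weight u * weight v \<le> K * birkhoff_prod R (length u) (u \<frown> v \<frown> x) * weight v"
      using weight_pos[OF that(2)] by (intro mult_right_mono) auto
    then show ?thesis by (simp only: weight_append mult.assoc)
  qed
  have inj: "inj_on (\<lambda>(u, v). u @ v) (?U \<times> ?V)"
  proof (rule inj_onI, clarify)
    fix u v u' v' assume "u \<in> ?U" "u' \<in> ?U" "u @ v = u' @ v'"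
    moreover have "length u = length u'" using calculation by (simp add: words_def)
    ultimately show "u = u' \<and> v = v'" by simp
  qed
  have "loop_sum n * loop_sum m = (\<Sum>(u, v)\<in>?U \<times> ?V. weight u * weight v)"
    by (simp add: loop_sum_def sum_product sum.cartesian_product)
  also have "\<dots> \<le> (\<Sum>(u, v)\<in>?U \<times> ?V. K * weight (u @ v))"
    using le by (intro sum_mono) auto
  also have "\<dots> = K * (\<Sum>w\<in>(\<lambda>(u, v). u @ v) ` (?U \<times> ?V). weight w)"
    unfolding sum_distrib_left by (subst sum.reindex[OF inj]) (simp add: case_prod_unfold)
  also have "\<dots> \<le> K * loop_sum (n + m)"
    unfolding loop_sum_def using K_pos app
    by (intro mult_left_mono sum_mono2 finite_words) (auto intro: less_imp_le weight_pos)
  finally show ?thesis .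
qed

definition "periodic_sum n = (\<Sum>y\<in>{y \<in> X. suffix n y = y \<and> y 0 = A}. birkhoff_prod R n y)"

text \<open>A loop \<open>w\<close> closes up to the periodic point \<open>w\<^sup>\<omega>\<close>, which shares the prefix \<open>w\<close> with \<open>wx\<close>.\<close>

lemma loop_sum_le_periodic_sum:
  assumes n: "n \<ge> 1"
  shows "loop_sum n \<le> K * periodic_sum n"
proof -
  let ?P = "{y \<in> X. suffix n y = y \<and> y 0 = A}"
  have mem: "w\<^sup>\<omega> \<in> ?P" and le: "weight w \<le> K * birkhoff_prod R n (w\<^sup>\<omega>)"
    and pre: "prefix n (w\<^sup>\<omega>) = w" if "w \<in> words \<tau> n A a" for w
  proof -
    have w: "w \<noteq> []" "successively \<tau> w" "length w = n" "hd w = A" "last w = a"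
      using that by (auto simp: words_def)
    have unroll: "w\<^sup>\<omega> = w \<frown> w\<^sup>\<omega>" using w by (intro iter_unroll) auto
    then show pre: "prefix n (w\<^sup>\<omega>) = w" using conc_prefix[OF w(3)] by metis
    have "suffix n (w\<^sup>\<omega>) = w\<^sup>\<omega>" using unroll conc_suffix[OF w(3)] by metis
    moreover have "w\<^sup>\<omega> \<in> X"
      unfolding shift_space_def
    proof (intro CollectI allI)
      fix i
      show "\<tau> (w\<^sup>\<omega> i) (w\<^sup>\<omega> (Suc i))"
      proof (cases "Suc (i mod n) = n")
        case True
        then have "i mod n = n - 1" "Suc i mod n = 0" by (auto simp: mod_Suc)
        then have "w\<^sup>\<omega> i = last w" "w\<^sup>\<omega> (Suc i) = hd w"
          using w n by (auto simp: hd_conv_nth last_conv_nth)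
        then show ?thesis using w aA by simp
      next
        case False
        moreover have "i mod n < n" using n by simp
        ultimately have "Suc (i mod n) < n" by linarith
        then show ?thesis using w n by (simp add: mod_Suc successively_nth)
      qed
    qed
    moreover have "(w\<^sup>\<omega>) 0 = A" using w n by (simp add: hd_conv_nth)
    ultimately show "w\<^sup>\<omega> \<in> ?P" by auto
    show "weight w \<le> K * birkhoff_prod R n (w\<^sup>\<omega>)"
      unfolding weight_def w(3)
      by (rule distortion) (use words_conc[OF that] \<open>w\<^sup>\<omega> \<in> X\<close> pre conc_prefix[OF w(3)] in auto)
  qed
  have fin: "finite ?P"
  proof (rule inj_on_finite[OF _ _ finite_prefixes[of n X]])
    have per: "y i = y (i mod n)" if "suffix n y = y" for y :: "'a word" and i
    proof (induction i rule: less_induct)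
      case (less i)
      show ?case
      proof (cases "i < n")
        case False
        have "y i = suffix n y (i - n)" using False by simp
        also have "\<dots> = y ((i - n) mod n)" using less[of "i - n"] False n that by simp
        finally show ?thesis using False by (simp add: le_mod_geq)
      qed simp
    qed
    show "inj_on (prefix n) ?P"
    proof (rule inj_onI, rule ext)
      fix y z i assume *: "y \<in> ?P" "z \<in> ?P" "prefix n y = prefix n z"
      have "y (i mod n) = z (i mod n)" using *(3) n unfolding prefix_eq_iff by simp
      then show "y i = z i" using per[of y i] per[of z i] * by simp
    qed
  qed auto
  have inj: "inj_on iter (words \<tau> n A a)" by (rule inj_onI) (metis pre)
  have "loop_sum n \<le> (\<Sum>w\<in>words \<tau> n A a. K * birkhoff_prod R n (w\<^sup>\<omega>))"
    unfolding loop_sum_def by (intro sum_mono le)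
  also have "\<dots> = K * (\<Sum>y\<in>iter ` words \<tau> n A a. birkhoff_prod R n y)"
    by (simp add: sum.reindex[OF inj] sum_distrib_left)
  also have "\<dots> \<le> K * periodic_sum n"
    unfolding periodic_sum_def using K_pos mem
    by (intro mult_left_mono sum_mono2 fin) (auto intro: less_imp_le birkhoff_pos)
  finally show ?thesis .
qed

text \<open>If \<open>loop_sum n = K r\<close> with \<open>r > 1\<close>, then supermultiplicativity makes the loop sums, and
  with them the periodic sums, grow at least like \<open>r\<^sup>k\<close> along the multiples \<open>n k\<close>, so that the
  pressure would be at least \<open>ln r / n > 0\<close>.\<close>

lemma loop_sum_bounded:
  assumes P: "pressure \<tau> R A = 0" and n: "n \<ge> 1"
  shows "loop_sum n \<le> K"
proof (rule ccontr)
  assume "\<not> loop_sum n \<le> K"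
  define r where "r = loop_sum n / K"
  have r: "r > 1" using K_pos \<open>\<not> loop_sum n \<le> K\<close> by (simp add: r_def)
  have pow: "K * r ^ Suc k \<le> loop_sum (n * Suc k)" for k
  proof (induction k)
    case 0 then show ?case using K_pos by (simp add: r_def)
  next
    case (Suc k)
    have "K * r ^ Suc (Suc k) = loop_sum n * (K * r ^ Suc k) / K"
      using K_pos by (simp add: r_def)
    also have "\<dots> \<le> loop_sum n * loop_sum (n * Suc k) / K"
      using Suc K_pos loop_sum_nonneg by (intro divide_right_mono mult_left_mono) auto
    also have "\<dots> \<le> K * loop_sum (n + n * Suc k) / K"
      using loop_sum_mult K_pos by (intro divide_right_mono) auto
    finally show ?case using K_pos by simp
  qed
  let ?f = "\<lambda>n. ereal (1 / real n * ln (periodic_sum n))"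
  define d where "d = ln r / real n"
  have "d > 0" using r n by (simp add: d_def)
  have "limsup ?f < ereal d"
    using P \<open>d > 0\<close> unfolding pressure_def periodic_sum_def[abs_def] by simp
  then have "eventually (\<lambda>n. ?f n < ereal d) sequentially" by (rule Limsup_lessD)
  then obtain N where N: "\<And>m. m \<ge> N \<Longrightarrow> ?f m < ereal d"
    by (auto simp: eventually_sequentially)
  have "N \<le> 1 * Suc N" by simp
  also have "\<dots> \<le> n * Suc N" using n by (intro mult_right_mono) auto
  finally have nN: "n * Suc N \<ge> N" .
  have nN1: "n * Suc N \<ge> 1" using n by simp
  have "K * r ^ Suc N \<le> K * periodic_sum (n * Suc N)"
    using pow[of N] loop_sum_le_periodic_sum[OF nN1] by linarith
  then have "r ^ Suc N \<le> periodic_sum (n * Suc N)"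
    using K_pos by (simp only: mult_le_cancel_left_pos)
  then have "ln (r ^ Suc N) \<le> ln (periodic_sum (n * Suc N))"
    using r by (intro ln_mono) (auto intro: less_le_trans[of 0 "r ^ Suc N"])
  moreover have "ln (r ^ Suc N) = real (Suc N) * ln r" by (rule ln_realpow)
  ultimately have "real (Suc N) * ln r / real (n * Suc N) \<le> ln (periodic_sum (n * Suc N)) / real (n * Suc N)"
    by (intro divide_right_mono) auto
  moreover have "real (Suc N) * ln r / real (n * Suc N) = d"
    unfolding d_def of_nat_mult by (simp del: of_nat_Suc)
  ultimately show False using N[OF nN] by simp
qed

text \<open>Bridging sends the words of length \<open>n\<close> to loops with lengths between \<open>n\<close> and \<open>n + slack\<close>.
  The function \<open>z\<close> is any choice of one point in each cylinder; distortion makes the choice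
  harmless, and leaving it free avoids suprema over cylinders.\<close>

lemma prefix_sum_bounded:
  assumes P: "pressure \<tau> R A = 0"
  obtains C where "C > 0"
    "\<And>n z. \<lbrakk>n \<ge> 1; \<And>w. w \<in> prefix n ` X \<Longrightarrow> z w \<in> X \<and> prefix n (z w) = w\<rbrakk> \<Longrightarrow>
      (\<Sum>w\<in>prefix n ` X. birkhoff_prod R n (z w)) \<le> C"
proof -
  define D where "D = K * exp L ^ slack"
  have D: "D > 0" using K_pos by (simp add: D_def)
  define C where "C = D * (real (CARD('a) ^ 2) * (real (Suc slack) * K))"
  have "(\<Sum>w\<in>prefix n ` X. birkhoff_prod R n (z w)) \<le> C"
    if n: "n \<ge> 1" and z: "\<And>w. w \<in> prefix n ` X \<Longrightarrow> z w \<in> X \<and> prefix n (z w) = w" for n z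
  proof -
    let ?F = "prefix n ` X"
    have fin: "finite ?F" by (rule finite_prefixes)
    have F: "length w = n" "w \<noteq> []" "successively \<tau> w" if "w \<in> ?F" for w
      using that n successively_prefix by auto
    have sub: "bridge ` ?F \<subseteq> (\<Union>m\<in>{n..n + slack}. words \<tau> m A a)"
    proof (rule image_subsetI)
      fix w assume w: "w \<in> ?F"
      show "bridge w \<in> (\<Union>m\<in>{n..n + slack}. words \<tau> m A a)"
        using bridge_words[OF F(2)[OF w] F(3)[OF w]] bridge_length[of w] F(1)[OF w]
        by (intro UN_I[of "length (bridge w)"]) auto
    qed
    have disj: "(\<Sum>w\<in>(\<Union>m\<in>{n..n + slack}. words \<tau> m A a). weight w) = (\<Sum>m\<in>{n..n + slack}. loop_sum m)"
      unfolding loop_sum_def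
      by (rule sum.UNION_disjoint) (auto simp: finite_words, auto simp: words_def)
    have nonneg: "0 \<le> weight w" if "w \<in> (\<Union>m\<in>{n..n + slack}. words \<tau> m A a)" for w
      using that by (auto intro: less_imp_le weight_pos)
    have "(\<Sum>w\<in>?F. birkhoff_prod R n (z w)) \<le> (\<Sum>w\<in>?F. D * weight (bridge w))"
    proof (rule sum_mono)
      fix w assume w: "w \<in> ?F"
      show "birkhoff_prod R n (z w) \<le> D * weight (bridge w)"
        using bridge_weight[of w "z w"] F[OF w] z[OF w] by (simp add: D_def)
    qed
    also have "\<dots> = D * (\<Sum>w\<in>?F. weight (bridge w))" by (simp only: sum_distrib_left)
    also have "\<dots> \<le> D * (real (CARD('a) ^ 2) * (\<Sum>w\<in>bridge ` ?F. weight w))"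
      using D by (intro mult_left_mono bridge_sum[OF fin] nonneg subsetD[OF sub]) auto
    also have "(\<Sum>w\<in>bridge ` ?F. weight w) \<le> (\<Sum>w\<in>(\<Union>m\<in>{n..n + slack}. words \<tau> m A a). weight w)"
      using sub nonneg by (intro sum_mono2) (auto simp: finite_words)
    also have "\<dots> = (\<Sum>m\<in>{n..n + slack}. loop_sum m)" by (rule disj)
    also have "\<dots> \<le> real (Suc slack) * K"
      using sum_bounded_above[of "{n..n+slack}" loop_sum K] loop_sum_bounded[OF P] n by simp
    finally show ?thesis using D by (simp add: C_def mult_left_mono)
  qed
  moreover have "C > 0" using D K_pos by (simp add: C_def)
  ultimately show thesis using that by blast
qed

end

section \<open>Domination by the density vector\<close>

locale twisted_walk = transitive_walk \<tau> R G s A a x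
  for \<tau> :: "'a::finite \<Rightarrow> 'a \<Rightarrow> bool" and R :: "'a word \<Rightarrow> real"
    and G :: "('g, 'm) monoid_scheme" (structure) and s A a x +
  fixes I :: "'i set" and H :: "'i \<Rightarrow> 'g set" and f :: "('i \<times> 'g set) ell2"
    and c :: "nat \<Rightarrow> real" and \<gamma> :: real
  assumes H_subgroup: "\<forall>i\<in>I. subgroup (H i) G"
    and f_cone: "f \<in> rep_cone G I H"
    and c_slow: "slowly_increasing c"
    and phi_finite: "t > \<gamma> \<Longrightarrow> phi_vec_finite \<tau> R G s A a x I H f c t"
begin

abbreviation "\<rho> \<equiv> quot_rep G I H"
abbreviation "\<phi> \<equiv> phi \<tau> R G s A a x c"
abbreviation "\<Phi> \<equiv> phi_vec \<tau> R G s A a x I H f c"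
definition "loops = (\<Union>n\<in>{1..}. words \<tau> n A a)"
text \<open>The coefficient of \<open>w\<close> in the density \<open>\<phi>\<^sub>c[t]\<close>.\<close>

definition "disc_weight t w = t powi (- int (length w)) * c (length w) * weight w"

lemma c_pos: "c n > 0" and c_mono: "m \<le> n \<Longrightarrow> c m \<le> c n"
  using c_slow by (auto simp: slowly_increasing_def mono_def)

lemma loops_words: "w \<in> loops \<longleftrightarrow> w \<in> words \<tau> (length w) A a"
proof
  assume "w \<in> words \<tau> (length w) A a"
  moreover from this have "length w \<ge> 1" by (auto simp: words_def Suc_le_eq)
  ultimately show "w \<in> loops" unfolding loops_def by blast
qed (auto simp: loops_def words_def)

lemma disc_weight_nonneg: "t > 0 \<Longrightarrow> w \<in> loops \<Longrightarrow> 0 \<le> disc_weight t w"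
  using weight_pos c_pos unfolding disc_weight_def loops_words by (simp add: less_imp_le)

lemma f_nonneg: "0 \<le> coord f p"
  using f_cone by (rule rep_cone_nonneg)

lemma rho_nonneg: "g \<in> carrier G \<Longrightarrow> (\<And>p. 0 \<le> coord v p) \<Longrightarrow> 0 \<le> coord (\<rho> g v) p"
  by (rule quot_rep_nonneg[OF is_group H_subgroup])

lemma phi_le_eq:
  "phi_le \<tau> R G s A a x c N t g = (\<Sum>w\<in>{w \<in> loops. length w \<le> N \<and> sp w = g}. disc_weight t w)"
proof -
  have eq: "{w \<in> loops. length w \<le> N \<and> sp w = g} = (\<Union>n\<in>{1..N}. {w \<in> words \<tau> n A a. sp w = g})"
    unfolding loops_def by (auto simp: words_def)
  have "phi_le \<tau> R G s A a x c N t g = (\<Sum>n\<in>{1..N}. \<Sum>w\<in>{w \<in> words \<tau> n A a. sp w = g}. disc_weight t w)"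
    unfolding phi_le_def sum_distrib_left
    by (intro sum.cong refl) (auto simp: disc_weight_def weight_def words_def)
  also have "\<dots> = (\<Sum>w\<in>{w \<in> loops. length w \<le> N \<and> sp w = g}. disc_weight t w)"
    unfolding eq by (rule sum.UNION_disjoint[symmetric]) (auto simp: finite_words, auto simp: words_def)
  finally show ?thesis .
qed

lemma finite_loops: "finite {w \<in> loops. length w \<le> N \<and> P w}"
  by (rule finite_subset[of _ "\<Union>n\<in>{1..N}. words \<tau> n A a"])
    (auto simp: finite_words, auto simp: loops_def words_def)

text \<open>The terms are non-negative, so the partial sums \<open>\<phi>\<^sub>c\<^sub>;\<^sub>\<le>\<^sub>N\<close> increase to \<open>\<phi>\<^sub>c\<close>.\<close>

lemma sum_disc_weight_le_phi:
  assumes t: "t > 0" "t > \<gamma>" and g: "g \<in> carrier G"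
    and F: "finite F" "F \<subseteq> loops" "\<And>w. w \<in> F \<Longrightarrow> sp w = g"
  shows "(\<Sum>w\<in>F. disc_weight t w) \<le> \<phi> t g"
proof -
  define N where "N = (\<Sum>w\<in>F. length w)"
  let ?p = "\<lambda>N. phi_le \<tau> R G s A a x c N t g"
  have "convergent ?p" using phi_finite[OF t(2)] g unfolding phi_vec_finite_def by blast
  then have lim: "?p \<longlonglongrightarrow> \<phi> t g" unfolding phi_def by (simp only: convergent_LIMSEQ_iff)
  have "incseq ?p"
    unfolding incseq_def phi_le_eq
    by (intro allI impI sum_mono2 finite_loops) (auto intro: disc_weight_nonneg t)
  then have "?p N \<le> \<phi> t g" using lim by (rule incseq_le)
  moreover have "(\<Sum>w\<in>F. disc_weight t w) \<le> ?p N"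
    unfolding phi_le_eq
  proof (intro sum_mono2 finite_loops subsetI)
    fix w assume "w \<in> F"
    then have "length w \<le> N" unfolding N_def using F(1) by (intro member_le_sum) auto
    then show "w \<in> {w \<in> loops. length w \<le> N \<and> sp w = g}" using F \<open>w \<in> F\<close> by auto
  qed (auto intro: disc_weight_nonneg t)
  ultimately show ?thesis by linarith
qed

text \<open>If \<open>\<gamma>\<close> were not positive, the density at the identity would be finite for every \<open>t > 0\<close>.
  But the powers of a single loop with trivial product contribute terms of size at least
  \<open>c\<^sub>0 (exp (- L) / t)\<^sup>m\<close> with unbounded lengths \<open>m\<close>, which diverge for small \<open>t\<close>.\<close>

lemma gamma_pos: "\<gamma> > 0"
proof (rule ccontr)
  assume "\<not> \<gamma> > 0"
  define q where "q = right_conn A"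
  define p where "p = left_conn (hd q)"
  define w where "w = p @ q"
  have q: "q \<noteq> []" "successively \<tau> q" "last q = a" "sp q = \<one>"
    using right_conn[of A] by (auto simp: q_def)
  have p: "p \<noteq> []" "successively \<tau> p" "hd p = A" "\<tau> (last p) (hd q)" "sp p = \<one>"
    using left_conn[of "hd q"] by (auto simp: p_def)
  have w: "w \<noteq> []" "successively \<tau> w" "hd w = A" "last w = a" "sp w = \<one>"
    using p q by (auto simp: w_def successively_append sp_append)
  define W where "W k = concat (replicate (Suc k) w)" for k
  have W: "W k \<noteq> [] \<and> successively \<tau> (W k) \<and> hd (W k) = A \<and> last (W k) = a \<and> sp (W k) = \<one>
      \<and> Suc k \<le> length (W k)" for k
  proof (induction k)
    case 0 then show ?case using w by (simp add: W_def Suc_le_eq)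
  next
    case (Suc k)
    have "W (Suc k) = w @ W k" by (simp add: W_def)
    moreover have "1 \<le> length w" using w by (simp add: Suc_le_eq)
    ultimately show ?case using Suc w aA
      by (simp add: successively_append sp_append hd_append last_append)
  qed
  \<comment> \<open>half the uniform lower bound of \<open>R\<close>, so that every letter contributes a factor of at least 2\<close>
  define t where "t = exp (- L) / 2"
  have "t > 0" by (simp add: t_def)
  then have t: "t > 0" "t > \<gamma>" using \<open>\<not> \<gamma> > 0\<close> by auto
  have "c 0 * 2 ^ Suc k \<le> \<phi> t \<one>" for k
  proof -
    let ?n = "length (W k)"
    have loop: "W k \<in> loops" using W[of k] by (auto simp: loops_words words_def)
    then have "exp (- L) ^ ?n \<le> weight (W k)"
      unfolding weight_def loops_words by (intro birkhoff_lower words_conc)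
    moreover have "c 0 \<le> c ?n" by (rule c_mono) simp
    ultimately have "t powi (- int ?n) * c 0 * exp (- L) ^ ?n \<le> disc_weight t (W k)"
      unfolding disc_weight_def using t c_pos[of ?n] c_pos[of 0] by (intro mult_mono) auto
    moreover have "t powi (- int ?n) * c 0 * exp (- L) ^ ?n = c 0 * 2 ^ ?n"
      unfolding t_def by (simp add: power_int_minus power_divide field_simps)
    moreover have "c 0 * 2 ^ Suc k \<le> c 0 * 2 ^ ?n"
      using c_pos[of 0] W[of k] by (intro mult_left_mono power_increasing) auto
    moreover have "disc_weight t (W k) \<le> \<phi> t \<one>"
      using sum_disc_weight_le_phi[OF t one_closed, of "{W k}"] loop W[of k] by simp
    ultimately show ?thesis by linarith
  qed
  then have bound: "2 ^ Suc k \<le> \<phi> t \<one> / c 0" for k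
    using c_pos[of 0] by (simp only: pos_le_divide_eq mult.commute)
  obtain k where "\<phi> t \<one> / c 0 < 2 ^ k" using real_arch_pow[of 2] by auto
  also have "(2::real) ^ k \<le> 2 ^ Suc k" by (rule power_increasing) auto
  finally show False using bound[of k] by simp
qed

text \<open>Grouping a finite set of loops by their group product bounds each group by a value of the
  density, and the finite sum over group elements by the series that defines \<open>\<Phi> t\<close>.\<close>

lemma sum_le_Phi_coord:
  assumes t: "t > \<gamma>" and F: "finite F" "F \<subseteq> loops"
  shows "coord (\<Sum>w\<in>F. disc_weight t w *\<^sub>R \<rho> (sp w) f) p \<le> coord (\<Phi> t) p"
proof -
  have t0: "t > 0" using t gamma_pos by simp
  have S: "(\<lambda>g. \<phi> t g *\<^sub>R \<rho> g f) summable_on carrier G"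
    using phi_finite[OF t] unfolding phi_vec_finite_def by blast
  have phi0: "0 \<le> \<phi> t g" if "g \<in> carrier G" for g
    using sum_disc_weight_le_phi[OF t0 t that, of "{}"] by simp
  have rho0: "0 \<le> coord (\<rho> g f) p" if "g \<in> carrier G" for g
    by (rule rho_nonneg[OF that f_nonneg])
  have Sp: "(\<lambda>g. \<phi> t g * coord (\<rho> g f) p) summable_on carrier G"
    using summable_on_bounded_linear[OF bounded_linear_coord[of p] S]
    by (simp add: coord_scaleR o_def)
  have "coord (\<Sum>w\<in>F. disc_weight t w *\<^sub>R \<rho> (sp w) f) p = (\<Sum>w\<in>F. disc_weight t w * coord (\<rho> (sp w) f) p)"
    by (simp add: coord_sum coord_scaleR)
  also have "\<dots> = (\<Sum>g\<in>sp ` F. \<Sum>w\<in>{w \<in> F. sp w = g}. disc_weight t w * coord (\<rho> (sp w) f) p)"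
    by (rule sum.image_gen[OF F(1)])
  also have "\<dots> = (\<Sum>g\<in>sp ` F. (\<Sum>w\<in>{w \<in> F. sp w = g}. disc_weight t w) * coord (\<rho> g f) p)"
    unfolding sum_distrib_right by (intro sum.cong) auto
  also have "\<dots> \<le> (\<Sum>g\<in>sp ` F. \<phi> t g * coord (\<rho> g f) p)"
    using F sp_carrier rho0
    by (intro sum_mono mult_right_mono sum_disc_weight_le_phi t t0) auto
  also have "\<dots> \<le> (\<Sum>\<^sub>\<infinity>g\<in>carrier G. \<phi> t g * coord (\<rho> g f) p)"
    using F(1) sp_carrier phi0 rho0 by (intro finite_sum_le_infsum Sp) auto
  also have "\<dots> = coord (\<Phi> t) p"
    unfolding phi_vec_def rep_conv_def
    using infsumI[OF has_sum_bounded_linear[OF bounded_linear_coord[of p] has_sum_infsum[OF S]]]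
    by (simp add: coord_scaleR o_def)
  finally show ?thesis .
qed

lemma Phi_nonneg: "t > \<gamma> \<Longrightarrow> 0 \<le> coord (\<Phi> t) p"
  using sum_le_Phi_coord[of t "{}" p] by (simp add: zero_ell2.rep_eq)

lemma sum_loops_le_inner:
  assumes t: "t > \<gamma>" and F: "finite F" "F \<subseteq> loops" and g: "g \<in> carrier G"
    and v: "\<And>p. 0 \<le> coord v p"
  shows "(\<Sum>w\<in>F. disc_weight t w * inner (\<rho> (g \<otimes> sp w) f) v) \<le> inner (\<rho> g (\<Phi> t)) v"
proof -
  have "(\<Sum>w\<in>F. disc_weight t w * inner (\<rho> (g \<otimes> sp w) f) v)
      = inner (\<Sum>w\<in>F. disc_weight t w *\<^sub>R \<rho> g (\<rho> (sp w) f)) v"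
    using quot_rep_mult[OF is_group H_subgroup g sp_carrier] by (simp add: inner_sum_left)
  also have "(\<Sum>w\<in>F. disc_weight t w *\<^sub>R \<rho> g (\<rho> (sp w) f)) = \<rho> g (\<Sum>w\<in>F. disc_weight t w *\<^sub>R \<rho> (sp w) f)"
    by (rule quot_rep_sum[OF is_group H_subgroup g, symmetric])
  also have "inner \<dots> v \<le> inner (\<rho> g (\<Phi> t)) v"
    by (intro inner_coord_mono quot_rep_mono[OF is_group H_subgroup g] sum_le_Phi_coord t F v)
  finally show ?thesis .
qed

text \<open>The price of bridging at parameters \<open>t \<le> T\<close>: distortion, the values of \<open>R\<close> and the powers
  of \<open>t\<close> at the added letters, and the multiplicity.\<close>

definition "bridge_const T = K * exp L ^ slack * max 1 T ^ slack * real (CARD('a) ^ 2)"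

lemma bridge_const_nonneg: "0 \<le> bridge_const T"
  using K_pos by (simp add: bridge_const_def)

text \<open>After bridging, the words are among those that define \<open>\<Phi> t\<close>. The constant depends on neither
  \<open>t\<close> nor \<open>F\<close>, so that it survives both the limit \<open>t \<rightarrow> \<gamma>\<close> and the passage to infinite sums.\<close>

lemma sum_words_le_inner:
  assumes t: "t > \<gamma>" "t \<le> T" and F: "finite F" and g: "g \<in> carrier G"
    and v: "\<And>p. 0 \<le> coord v p"
    and z: "\<And>u. u \<in> F \<Longrightarrow> u \<noteq> [] \<and> z u \<in> X \<and> prefix (length u) (z u) = u"
  shows "(\<Sum>u\<in>F. t powi (- int (length u)) * c (length u) * birkhoff_prod R (length u) (z u)
      * inner (\<rho> (g \<otimes> sp u) f) v) \<le> bridge_const T * inner (\<rho> g (\<Phi> t)) v"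
proof -
  have t0: "t > 0" using t gamma_pos by simp
  define D where "D = K * exp L ^ slack * max 1 T ^ slack"
  have D: "D \<ge> 0" using K_pos by (simp add: D_def)
  define h where "h w = disc_weight t w * inner (\<rho> (g \<otimes> sp w) f) v" for w
  have nonneg: "0 \<le> inner (\<rho> (g \<otimes> sp u) f) v" for u
    by (intro inner_coord_nonneg rho_nonneg f_nonneg v m_closed g sp_carrier)
  have loop: "bridge u \<in> loops" if "u \<in> F" for u
  proof -
    have "successively \<tau> (prefix (length u) (z u))" using z[OF that] by (intro successively_prefix) auto
    then show ?thesis unfolding loops_words using z[OF that] by (intro bridge_words) auto
  qed
  have "(\<Sum>u\<in>F. t powi (- int (length u)) * c (length u) * birkhoff_prod R (length u) (z u)
      * inner (\<rho> (g \<otimes> sp u) f) v) \<le> (\<Sum>u\<in>F. D * h (bridge u))"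
  proof (rule sum_mono)
    fix u assume u: "u \<in> F"
    let ?m = "length u" and ?b = "length (bridge u)"
    have "t ^ (?b - ?m) \<le> max 1 T ^ (?b - ?m)" using t t0 by (intro power_mono) auto
    also have "\<dots> \<le> max 1 T ^ slack" using bridge_length[of u] by (intro power_increasing) auto
    finally have le: "t ^ (?b - ?m) \<le> max 1 T ^ slack" .
    have "t powi (- int ?m) = t powi (- int ?b) * t ^ (?b - ?m)"
      using t0 bridge_length(1)[of u]
      by (simp add: power_int_minus power_diff field_simps)
    also have "\<dots> \<le> t powi (- int ?b) * max 1 T ^ slack" using le t0 by (intro mult_left_mono) auto
    finally have 1: "t powi (- int ?m) \<le> t powi (- int ?b) * max 1 T ^ slack" .
    have 2: "c ?m \<le> c ?b" by (rule c_mono) (rule bridge_length)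
    have 3: "birkhoff_prod R ?m (z u) \<le> K * exp L ^ slack * weight (bridge u)"
      using z[OF u] by (intro bridge_weight) auto
    have pos: "0 \<le> birkhoff_prod R ?m (z u)" using z[OF u] by (intro less_imp_le birkhoff_pos) auto
    have "t powi (- int ?m) * c ?m * birkhoff_prod R ?m (z u) \<le>
        (t powi (- int ?b) * max 1 T ^ slack) * c ?b * (K * exp L ^ slack * weight (bridge u))"
      using c_pos[of ?m] c_pos[of ?b] t0 pos by (intro mult_mono 1 2 3) auto
    also have "\<dots> = D * disc_weight t (bridge u)" by (simp add: D_def disc_weight_def)
    finally have "t powi (- int ?m) * c ?m * birkhoff_prod R ?m (z u) * inner (\<rho> (g \<otimes> sp u) f) v
        \<le> D * disc_weight t (bridge u) * inner (\<rho> (g \<otimes> sp u) f) v"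
      using nonneg by (rule mult_right_mono)
    then show "t powi (- int ?m) * c ?m * birkhoff_prod R ?m (z u) * inner (\<rho> (g \<otimes> sp u) f) v
        \<le> D * h (bridge u)"
      by (simp add: h_def sp_bridge)
  qed
  also have "\<dots> = D * (\<Sum>u\<in>F. h (bridge u))" by (simp only: sum_distrib_left)
  also have "\<dots> \<le> D * (real (CARD('a) ^ 2) * (\<Sum>w\<in>bridge ` F. h w))"
    using loop by (intro mult_left_mono bridge_sum F D)
      (auto simp: h_def intro!: mult_nonneg_nonneg disc_weight_nonneg t0 nonneg)
  also have "\<dots> \<le> D * (real (CARD('a) ^ 2) * inner (\<rho> g (\<Phi> t)) v)"
    unfolding h_def using loop F
    by (intro mult_left_mono sum_loops_le_inner t g v D) auto
  also have "\<dots> = bridge_const T * inner (\<rho> g (\<Phi> t)) v" by (simp add: bridge_const_def D_def)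
  finally show ?thesis .
qed

end

section \<open>Cylinder masses of the twisted sums\<close>

lemma nn_integral_count_space_bound:
  fixes h :: "'b \<Rightarrow> ennreal" and l :: "'b \<Rightarrow> nat"
  assumes fin: "\<And>N. finite {v \<in> W. l v \<le> N}" and le: "\<And>N. (\<Sum>v\<in>{v \<in> W. l v \<le> N}. h v) \<le> B"
  shows "(\<integral>\<^sup>+ v. h v \<partial>count_space W) \<le> B"
proof -
  let ?h = "\<lambda>N v. h v * indicator {v. l v \<le> N} v"
  have "h v = (SUP N. ?h N v)" for v
  proof (rule antisym)
    show "h v \<le> (SUP N. ?h N v)" by (rule SUP_upper2[of "l v"]) auto
    show "(SUP N. ?h N v) \<le> h v" by (rule SUP_least) (auto simp: indicator_def)
  qed
  then have "(\<integral>\<^sup>+ v. h v \<partial>count_space W) = (\<integral>\<^sup>+ v. (SUP N. ?h N v) \<partial>count_space W)" by simp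
  also have "\<dots> = (SUP N. \<integral>\<^sup>+ v. ?h N v \<partial>count_space W)"
    by (rule nn_integral_monotone_convergence_SUP) (auto simp: incseq_def le_fun_def indicator_def)
  also have "\<dots> \<le> B"
  proof (rule SUP_least)
    fix N
    have "(\<integral>\<^sup>+ v. ?h N v \<partial>count_space W) = (\<Sum>v\<in>{v \<in> W. l v \<le> N}. ?h N v)"
      by (rule nn_integral_count_space'[OF fin]) auto
    also have "\<dots> = (\<Sum>v\<in>{v \<in> W. l v \<le> N}. h v)" by (intro sum.cong) auto
    finally show "(\<integral>\<^sup>+ v. ?h N v \<partial>count_space W) \<le> B" using le[of N] by simp
  qed
  finally show ?thesis .
qed

text \<open>The quotient \<open>c\<^sub>m\<^sub>+\<^sub>n / c\<^sub>m\<close> is a product of \<open>n\<close> ratios of consecutive terms, each of which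
  tends to one; any constant above one could replace 2.\<close>

lemma slowly_increasing_eventually:
  assumes "slowly_increasing c"
  shows "eventually (\<lambda>m. c (m + n) \<le> 2 * c m) sequentially"
proof -
  have pos: "c m > 0" for m using assms by (simp add: slowly_increasing_def)
  have r: "(\<lambda>m. c (Suc m) / c m) \<longlonglongrightarrow> 1" using assms by (simp add: slowly_increasing_def)
  have "(\<lambda>m. c (m + n) / c m) \<longlonglongrightarrow> 1"
  proof (induction n)
    case 0
    have "c m / c m = 1" for m using pos[of m] by simp
    then show ?case by simp
  next
    case (Suc n)
    have "(\<lambda>m. c (Suc (m + n)) / c (m + n)) \<longlonglongrightarrow> 1"
      using LIMSEQ_ignore_initial_segment[OF r, of n] by simp
    then have "(\<lambda>m. c (Suc (m + n)) / c (m + n) * (c (m + n) / c m)) \<longlonglongrightarrow> 1 * 1"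
      using Suc by (rule tendsto_mult)
    moreover have "c (Suc (m + n)) / c (m + n) * (c (m + n) / c m) = c (m + Suc n) / c m" for m
      using pos[of "m + n"] by simp
    ultimately show ?case by (simp only: mult_1)
  qed
  then have "eventually (\<lambda>m. c (m + n) / c m < 2) sequentially"
    by (rule order_tendstoD) simp
  then show ?thesis
    by eventually_elim (use pos in \<open>simp add: pos_divide_less_eq less_imp_le\<close>)
qed

context twisted_walk
begin

text \<open>The index set of the Dirac masses in \<^const>\<open>twisted_sum\<close>, whose weights are given by \<open>mass\<close>.\<close>

definition "words_to_a = (\<Union>B. \<Union>n\<in>{1..}. words \<tau> n B a)"

lemma words_to_a_conc: "v \<in> words_to_a \<Longrightarrow> v \<frown> x \<in> X"
  by (auto simp: words_to_a_def intro: words_conc)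

lemma finite_words_to_a: "finite {v \<in> words_to_a. length v \<le> N}"
  by (rule finite_subset[of _ "\<Union>n\<in>{..N}. {w. length w = n}"])
    (auto intro: finite_words_of_length)

definition "mass t v = t powi (- int (length v)) * c (length v) * birkhoff_prod R (length v) (v \<frown> x) *
  (inner (\<rho> (sp v) f) (\<Phi> t) / (norm (\<Phi> t))\<^sup>2)"

lemma inner_rho_nonneg: 
  "t > \<gamma> \<Longrightarrow> g \<in> carrier G \<Longrightarrow> 0 \<le> inner (\<rho> g f) (\<Phi> t)"
  by (intro inner_coord_nonneg rho_nonneg f_nonneg Phi_nonneg)

lemma mass_nonneg: "t > \<gamma> \<Longrightarrow> v \<in> words_to_a \<Longrightarrow> 0 \<le> mass t v"
  unfolding mass_def using c_pos gamma_pos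
  by (intro mult_nonneg_nonneg divide_nonneg_nonneg inner_rho_nonneg sp_carrier
      less_imp_le[OF birkhoff_pos] words_to_a_conc) (auto intro: less_imp_le)

text \<open>The functions on the group whose limit along \<open>tk\<close> is \<open>\<Upsilon>\<close>.\<close>

definition "Upsilon_at t g = inner (\<rho> g (\<Phi> t)) (\<Phi> t) / (norm (\<Phi> t))\<^sup>2"

text \<open>A long word in the cylinder is \<open>v = wu\<close> with \<open>|u| \<ge> M\<close>. Its mass is, up to \<open>2 K\<close> for the growth
  of \<open>c\<close> and for distortion, a factor that depends on \<open>w\<close> alone times the contribution of \<open>u\<close>;
  the sum over \<open>u\<close> is dominated by the density vector.\<close>

lemma long_mass_sum_le:
  assumes t: "t > \<gamma>" "t \<le> T" and z: "z \<in> X"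
    and M: "M \<ge> 1" "\<And>m. m \<ge> M \<Longrightarrow> c (m + n) \<le> 2 * c m"
    and F: "finite F" "\<And>v. v \<in> F \<Longrightarrow> v \<in> words_to_a \<and> n + M \<le> length v \<and> take n v = prefix n z"
  shows "(\<Sum>v\<in>F. mass t v) \<le>
    2 * K * t powi (- int n) * birkhoff_prod R n z * (bridge_const T * Upsilon_at t (sp (prefix n z)))"
proof -
  have t0: "t > 0" using t gamma_pos by simp
  let ?w = "prefix n z" and ?E = "drop n ` F"
  define B where "B = 2 * K * t powi (- int n) * birkhoff_prod R n z"
  have B: "B \<ge> 0" using K_pos t0 birkhoff_pos[OF z, of n] by (simp add: B_def less_imp_le)
  define q where "q u = t powi (- int (length u)) * c (length u) * birkhoff_prod R (length u) (u \<frown> x)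
      * inner (\<rho> (sp ?w \<otimes> sp u) f) (\<Phi> t)" for u
  have split: "v = ?w @ drop n v" if "v \<in> F" for v
    using F(2)[OF that] append_take_drop_id[of n v] by metis
  have inj: "inj_on (drop n) F" by (rule inj_onI) (metis split)
  have E: "u \<noteq> [] \<and> u \<frown> x \<in> X \<and> prefix (length u) (u \<frown> x) = u" if u: "u \<in> ?E" for u
  proof -
    obtain v where v: "v \<in> F" "u = drop n v" using u by auto
    have "suffix n (v \<frown> x) \<in> X" using F(2)[OF v(1)] by (intro shift_space_suffix words_to_a_conc) auto
    then show ?thesis using F(2)[OF v(1)] v M(1) by simp
  qed
  have "mass t v \<le> B * (q (drop n v) / (norm (\<Phi> t))\<^sup>2)" if v: "v \<in> F" for v
  proof -
    define u where "u = drop n v"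
    let ?m = "length u"
    have vu: "v = ?w @ u" using split[OF v] by (simp add: u_def)
    have len: "length v = n + ?m" by (subst vu) simp
    have m: "?m \<ge> M" using F(2)[OF v] len by linarith
    have vX: "v \<frown> x \<in> X" using F(2)[OF v] by (intro words_to_a_conc) auto
    have uX: "u \<frown> x \<in> X" using E v by (auto simp: u_def)
    have suf: "suffix n (v \<frown> x) = u \<frown> x" using len by (simp add: u_def)
    have "birkhoff_prod R (length v) (v \<frown> x) = birkhoff_prod R n (v \<frown> x) * birkhoff_prod R ?m (u \<frown> x)"
      by (simp only: len birkhoff_prod_add suf)
    also have "\<dots> \<le> K * birkhoff_prod R n z * birkhoff_prod R ?m (u \<frown> x)"
      by (intro mult_right_mono distortion vX z less_imp_le[OF birkhoff_pos] uX)
        (use F(2)[OF v] len in simp)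
    finally have 1: "birkhoff_prod R (length v) (v \<frown> x) \<le> K * birkhoff_prod R n z * birkhoff_prod R ?m (u \<frown> x)" .
    have 2: "c (length v) \<le> 2 * c ?m" using M(2)[OF m] by (simp add: len add.commute)
    have 3: "t powi (- int (length v)) = t powi (- int n) * t powi (- int ?m)"
      using t0 by (simp add: len power_int_add[symmetric])
    have i0: "0 \<le> inner (\<rho> (sp v) f) (\<Phi> t)" by (rule inner_rho_nonneg[OF t(1) sp_carrier])
    have "mass t v \<le> t powi (- int n) * t powi (- int ?m) * (2 * c ?m) *
        (K * birkhoff_prod R n z * birkhoff_prod R ?m (u \<frown> x)) *
        (inner (\<rho> (sp v) f) (\<Phi> t) / (norm (\<Phi> t))\<^sup>2)"
      unfolding mass_def 3 using t0 c_pos i0 less_imp_le[OF birkhoff_pos[OF vX]]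
      by (intro mult_right_mono mult_mono 1 2) (auto intro: less_imp_le)
    also have "\<dots> = B * (q u / (norm (\<Phi> t))\<^sup>2)"
      by (simp add: B_def q_def vu sp_append)
    finally show ?thesis by (simp add: u_def)
  qed
  then have "(\<Sum>v\<in>F. mass t v) \<le> (\<Sum>v\<in>F. B * (q (drop n v) / (norm (\<Phi> t))\<^sup>2))" by (rule sum_mono)
  also have "\<dots> = B * ((\<Sum>u\<in>?E. q u) / (norm (\<Phi> t))\<^sup>2)"
    by (simp add: sum.reindex[OF inj] sum_distrib_left sum_divide_distrib)
  also have "\<dots> \<le> B * (bridge_const T * inner (\<rho> (sp ?w) (\<Phi> t)) (\<Phi> t) / (norm (\<Phi> t))\<^sup>2)"
    unfolding q_def using B F(1) E
    by (intro mult_left_mono divide_right_mono sum_words_le_inner t sp_carrier Phi_nonneg) auto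
  finally show ?thesis by (simp add: B_def Upsilon_at_def)
qed

lemma twisted_cylinder_le:
  assumes t: "t > \<gamma>" "t \<le> T" and z: "z \<in> X"
    and M: "M \<ge> 1" "\<And>m. m \<ge> M \<Longrightarrow> c (m + n) \<le> 2 * c m"
  shows "measure (twisted_sum \<tau> R G s A a x I H f c t) {y \<in> X. prefix n y = prefix n z} \<le>
    (\<Sum>v\<in>{v \<in> words_to_a. length v \<le> n + M}. mass t v) +
    2 * K * t powi (- int n) * birkhoff_prod R n z * (bridge_const T * Upsilon_at t (sp (prefix n z)))"
    (is "measure ?\<mu> ?D \<le> ?S + ?L")
proof -
  have t0: "t > 0" using t gamma_pos by simp
  have S0: "0 \<le> ?S" by (intro sum_nonneg mass_nonneg t) auto
  have L0: "0 \<le> ?L" using long_mass_sum_le[OF t z M, of "{}"] by simp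
  define h where "h v = (if prefix n (v \<frown> x) = prefix n z then mass t v else 0)" for v
  have conc: "(\<lambda>v. v \<frown> x) \<in> measurable (density (count_space words_to_a) (\<lambda>v. ennreal (mass t v))) (shift_borel \<tau>)"
    using words_to_a_conc by (auto simp: space_shift_borel)
  have D: "?D \<in> sets (shift_borel \<tau>)" by (rule sets_prefix_pred)
  have "emeasure ?\<mu> ?D = emeasure (density (count_space words_to_a) (\<lambda>v. ennreal (mass t v))) ((\<lambda>v. v \<frown> x) -` ?D \<inter> words_to_a)"
    unfolding twisted_sum_def words_to_a_def[symmetric] mass_def[symmetric]
    using emeasure_distr[OF conc D] by simp
  also have "\<dots> = (\<integral>\<^sup>+ v. ennreal (mass t v) * indicator ((\<lambda>v. v \<frown> x) -` ?D \<inter> words_to_a) v \<partial>count_space words_to_a)"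
    by (rule emeasure_density) auto
  also have "\<dots> = (\<integral>\<^sup>+ v. ennreal (h v) \<partial>count_space words_to_a)"
    by (rule nn_integral_cong) (auto simp: h_def indicator_def words_to_a_conc)
  also have "\<dots> \<le> ennreal (?S + ?L)"
  proof (rule nn_integral_count_space_bound[where l = length])
    fix N
    let ?E = "{v \<in> words_to_a. length v \<le> N}"
    show fin: "finite ?E" by (rule finite_words_to_a)
    have h0: "0 \<le> h v" if "v \<in> words_to_a" for v using mass_nonneg[OF t(1) that] by (simp add: h_def)
    let ?s = "{v \<in> ?E. length v \<le> n + M}" and ?l = "{v \<in> ?E. n + M < length v \<and> prefix n (v \<frown> x) = prefix n z}"
    have "(\<Sum>v\<in>?E. h v) = (\<Sum>v\<in>?s. h v) + (\<Sum>v\<in>?E - ?s. h v)"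
      by (subst sum.subset_diff[of ?s]) (use fin in auto)
    also have "(\<Sum>v\<in>?s. h v) \<le> (\<Sum>v\<in>?s. mass t v)"
      by (intro sum_mono) (auto simp: h_def mass_nonneg t)
    also have "(\<Sum>v\<in>?s. mass t v) \<le> ?S"
      by (intro sum_mono2 finite_words_to_a) (auto intro: mass_nonneg t)
    also have "(\<Sum>v\<in>?E - ?s. h v) = (\<Sum>v\<in>?l. mass t v)"
      by (rule sum.mono_neutral_cong_right) (use fin in \<open>auto simp: h_def\<close>)
    also have "\<dots> \<le> ?L"
    proof (rule long_mass_sum_le[OF t z M])
      show "finite ?l" by (rule finite_subset[OF _ fin]) auto
    qed auto
    finally have "(\<Sum>v\<in>?E. h v) \<le> ?S + ?L" by simp
    then have "ennreal (\<Sum>v\<in>?E. h v) \<le> ennreal (?S + ?L)" by (rule ennreal_leI)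
    then show "(\<Sum>v\<in>?E. ennreal (h v)) \<le> ennreal (?S + ?L)"
      using h0 by (subst sum_ennreal) auto
  qed
  finally show ?thesis
    unfolding measure_def using S0 L0 by (intro enn2real_leI) auto
qed

end

section \<open>Cylinder masses of the twisted measure\<close>

locale twisted_limit = twisted_walk \<tau> R G s A a x I H f c \<gamma>
  for \<tau> :: "'a::finite \<Rightarrow> 'a \<Rightarrow> bool" and R :: "'a word \<Rightarrow> real"
    and G :: "('g, 'm) monoid_scheme" (structure) and s A a x
    and I :: "'i set" and H :: "'i \<Rightarrow> 'g set" and f c \<gamma> +
  fixes tk :: "nat \<Rightarrow> real" and \<nu> :: "'a word measure" and \<Upsilon> :: "'g \<Rightarrow> real"
  assumes tk_gt: "tk k > \<gamma>"
    and tk_lim: "tk \<longlonglongrightarrow> \<gamma>"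
    and norm_lim: "filterlim (\<lambda>t. norm (\<Phi> t)) at_top (at_right \<gamma>)"
    and weak_lim: "weak_star_limit (shift_top \<tau>) (\<lambda>k. twisted_sum \<tau> R G s A a x I H f c (tk k)) \<nu>"
    and Upsilon_lim: "g \<in> carrier G \<Longrightarrow> (\<lambda>k. Upsilon_at (tk k) g) \<longlonglongrightarrow> \<Upsilon> g"
    and pressure_zero: "pressure \<tau> R A = 0"
begin

text \<open>The numerator is at most linear in \<open>\<parallel>\<Phi> t\<parallel>\<close>, the denominator is quadratic, and the norm
  diverges.\<close>

lemma mass_vanishes: "(\<lambda>k. mass (tk k) v) \<longlonglongrightarrow> 0"
proof -
  have "filterlim tk (at_right \<gamma>) sequentially"
    using tk_lim tk_gt less_imp_neq[OF tk_gt] by (simp add: filterlim_at eq_commute)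
  then have "filterlim (\<lambda>k. norm (\<Phi> (tk k))) at_top sequentially"
    by (rule filterlim_compose[OF norm_lim])
  then have lim0: "(\<lambda>k. norm (\<rho> (sp v) f) / norm (\<Phi> (tk k))) \<longlonglongrightarrow> 0"
    by (intro tendsto_divide_0[OF tendsto_const] filterlim_at_top_imp_at_infinity)
  have "(\<lambda>k. inner (\<rho> (sp v) f) (\<Phi> (tk k)) / (norm (\<Phi> (tk k)))\<^sup>2) \<longlonglongrightarrow> 0"
  proof (rule Lim_null_comparison[OF always_eventually[OF allI] lim0])
    fix k
    have "\<bar>inner (\<rho> (sp v) f) (\<Phi> (tk k))\<bar> / (norm (\<Phi> (tk k)))\<^sup>2 \<le>
        norm (\<rho> (sp v) f) * norm (\<Phi> (tk k)) / (norm (\<Phi> (tk k)))\<^sup>2"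
      by (intro divide_right_mono Cauchy_Schwarz_ineq2) auto
    also have "\<dots> = norm (\<rho> (sp v) f) / norm (\<Phi> (tk k))" by (simp add: power2_eq_square)
    finally show "norm (inner (\<rho> (sp v) f) (\<Phi> (tk k)) / (norm (\<Phi> (tk k)))\<^sup>2) \<le>
        norm (\<rho> (sp v) f) / norm (\<Phi> (tk k))" by simp
  qed
  then have "(\<lambda>k. tk k powi (- int (length v)) * c (length v) * birkhoff_prod R (length v) (v \<frown> x) *
      (inner (\<rho> (sp v) f) (\<Phi> (tk k)) / (norm (\<Phi> (tk k)))\<^sup>2)) \<longlonglongrightarrow>
      \<gamma> powi (- int (length v)) * c (length v) * birkhoff_prod R (length v) (v \<frown> x) * 0"
    using gamma_pos by (intro tendsto_intros tk_lim) auto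
  then show ?thesis by (simp add: mass_def)
qed

text \<open>The threshold \<open>M\<close> beyond which \<open>c\<close> at most doubles depends on \<open>n\<close>, but the finitely many words
  below it lose their mass in the limit. This is why \<open>C\<close> is uniform in \<open>n\<close>, with no
  subexponential correction, as the bound \<open>n\<^sup>-\<^sup>2 \<gamma>\<^sup>n\<close> requires.\<close>

lemma cylinder_bound:
  obtains C where "C \<ge> 0" "\<And>n z. z \<in> X \<Longrightarrow> measure \<nu> {y \<in> X. prefix n y = prefix n z} \<le>
      C * \<gamma> powi (- int n) * birkhoff_prod R n z * \<Upsilon> (sp (prefix n z))"
proof -
  obtain T where T: "\<And>k. norm (tk k) \<le> T"
    using convergent_imp_Bseq[OF convergentI[OF tk_lim]] by (auto simp: Bseq_def)
  have tT: "tk k \<le> T" for k using T[of k] by simp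
  let ?\<mu> = "\<lambda>k. twisted_sum \<tau> R G s A a x I H f c (tk k)"
  have "measure \<nu> {y \<in> X. prefix n y = prefix n z} \<le>
      (2 * K * bridge_const T) * \<gamma> powi (- int n) * birkhoff_prod R n z * \<Upsilon> (sp (prefix n z))"
    if z: "z \<in> X" for n z
  proof -
    obtain M0 where M0: "\<And>m. m \<ge> M0 \<Longrightarrow> c (m + n) \<le> 2 * c m"
      using slowly_increasing_eventually[OF c_slow, of n] by (auto simp: eventually_sequentially)
    define M where "M = Suc M0"
    have M: "M \<ge> 1" "\<And>m. m \<ge> M \<Longrightarrow> c (m + n) \<le> 2 * c m" using M0 by (auto simp: M_def)
    let ?b = "\<lambda>k. (\<Sum>v\<in>{v \<in> words_to_a. length v \<le> n + M}. mass (tk k) v) +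
      2 * K * tk k powi (- int n) * birkhoff_prod R n z * (bridge_const T * Upsilon_at (tk k) (sp (prefix n z)))"
    have "?b \<longlonglongrightarrow> (\<Sum>v\<in>{v \<in> words_to_a. length v \<le> n + M}. 0) +
      2 * K * \<gamma> powi (- int n) * birkhoff_prod R n z * (bridge_const T * \<Upsilon> (sp (prefix n z)))"
      using gamma_pos by (intro tendsto_intros mass_vanishes tk_lim Upsilon_lim sp_carrier) auto
    moreover have "(\<lambda>k. measure (?\<mu> k) {y \<in> X. prefix n y = prefix n z})
        \<longlonglongrightarrow> measure \<nu> {y \<in> X. prefix n y = prefix n z}"
      by (rule weak_star_limit_prefix_pred[OF weak_lim])
    moreover have "measure (?\<mu> k) {y \<in> X. prefix n y = prefix n z} \<le> ?b k" for k
      by (rule twisted_cylinder_le[OF tk_gt tT z M])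
    ultimately have "measure \<nu> {y \<in> X. prefix n y = prefix n z} \<le>
        (\<Sum>v\<in>{v \<in> words_to_a. length v \<le> n + M}. 0) +
        2 * K * \<gamma> powi (- int n) * birkhoff_prod R n z * (bridge_const T * \<Upsilon> (sp (prefix n z)))"
      by (intro LIMSEQ_le) auto
    then show ?thesis by (simp add: algebra_simps)
  qed
  then show thesis using that[of "2 * K * bridge_const T"] K_pos bridge_const_nonneg by simp
qed

section \<open>Borel-Cantelli estimates\<close>

definition "point_of w = (SOME y. y \<in> X \<and> prefix (length w) y = w)"

lemma point_of: "w \<in> prefix n ` X \<Longrightarrow> point_of w \<in> X \<and> prefix n (point_of w) = w \<and> length w = n"
proof -
  assume "w \<in> prefix n ` X"
  then obtain y where y: "y \<in> X" "w = prefix n y" by auto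
  then have "\<exists>y. y \<in> X \<and> prefix (length w) y = w" by auto
  then have "point_of w \<in> X \<and> prefix (length w) (point_of w) = w"
    unfolding point_of_def by (rule someI_ex)
  then show ?thesis using y by simp
qed

text \<open>The points that violate the inequality at length \<open>n\<close> fill cylinders on which \<open>\<Upsilon>\<close> is smaller
  than \<open>b\<close>, so \<open>b\<close> may replace \<open>\<Upsilon>\<close> in the bound for their masses.\<close>

lemma AE_Upsilon_ge:
  assumes b0: "\<And>n g. g \<in> carrier G \<Longrightarrow> 0 \<le> b n g"
    and b: "summable (\<lambda>n. \<Sum>w\<in>prefix (Suc n) ` X.
        \<gamma> powi (- int (Suc n)) * birkhoff_prod R (Suc n) (point_of w) * b (Suc n) (sp w))"
  shows "AE y in \<nu>. \<exists>N. \<forall>n\<ge>N. b n (sp (prefix n y)) \<le> \<Upsilon> (sp (prefix n y))"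
proof -
  obtain C where C: "C \<ge> 0" "\<And>n z. z \<in> X \<Longrightarrow> measure \<nu> {y \<in> X. prefix n y = prefix n z} \<le>
      C * \<gamma> powi (- int n) * birkhoff_prod R n z * \<Upsilon> (sp (prefix n z))"
    using cylinder_bound by blast
  have sets: "sets \<nu> = sets (shift_borel \<tau>)" and fin: "finite_measure \<nu>"
    using weak_lim unfolding weak_star_limit_def sigma_opens_eq by auto
  interpret \<nu>: finite_measure \<nu> by (rule fin)
  have space: "space \<nu> = X"
    using sets_eq_imp_space_eq[OF sets] by (simp add: space_shift_borel)
  define Bad where "Bad n = {y \<in> X. \<Upsilon> (sp (prefix (Suc n) y)) < b (Suc n) (sp (prefix (Suc n) y))}" for n
  have Bad_sets: "Bad n \<in> sets \<nu>" for n
    unfolding Bad_def sets by (rule sets_prefix_pred)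
  let ?S = "\<lambda>n. \<Sum>w\<in>prefix (Suc n) ` X.
        \<gamma> powi (- int (Suc n)) * birkhoff_prod R (Suc n) (point_of w) * b (Suc n) (sp w)"
  have meas: "measure \<nu> (Bad n) \<le> C * ?S n" for n
  proof -
    let ?n = "Suc n"
    let ?W = "{w \<in> prefix ?n ` X. \<Upsilon> (sp w) < b ?n (sp w)}"
    have fin: "finite (prefix ?n ` X)" by (rule finite_prefixes)
    have pos: "0 \<le> C * (\<gamma> powi (- int ?n) * birkhoff_prod R ?n (point_of w))" if "w \<in> prefix ?n ` X" for w
      using C(1) gamma_pos point_of[OF that] birkhoff_pos[of "point_of w" ?n]
      by (intro mult_nonneg_nonneg) (auto intro: less_imp_le)
    have "Bad n = (\<Union>w\<in>?W. {y \<in> X. prefix ?n y = prefix ?n (point_of w)})"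
    proof (intro equalityI subsetI)
      fix y assume y: "y \<in> Bad n"
      then have W: "prefix ?n y \<in> ?W" by (simp add: Bad_def)
      then have "prefix ?n (point_of (prefix ?n y)) = prefix ?n y" using point_of by blast
      then show "y \<in> (\<Union>w\<in>?W. {y \<in> X. prefix ?n y = prefix ?n (point_of w)})"
        using y by (intro UN_I[OF W]) (simp add: Bad_def)
    next
      fix y assume "y \<in> (\<Union>w\<in>?W. {y \<in> X. prefix ?n y = prefix ?n (point_of w)})"
      then obtain w where w: "w \<in> ?W" "y \<in> X" "prefix ?n y = prefix ?n (point_of w)" by blast
      moreover have "prefix ?n (point_of w) = w" using point_of w(1) by blast
      ultimately show "y \<in> Bad n" by (simp add: Bad_def)
    qed
    then have "measure \<nu> (Bad n) = measure \<nu> (\<Union>w\<in>?W. {y \<in> X. prefix ?n y = prefix ?n (point_of w)})"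
      by (rule arg_cong)
    also have "\<dots> \<le> (\<Sum>w\<in>?W. measure \<nu> {y \<in> X. prefix ?n y = prefix ?n (point_of w)})"
    proof (rule measure_UNION_le)
      show "finite ?W" using fin by simp
      show "{y \<in> X. prefix ?n y = prefix ?n (point_of w)} \<in> sets \<nu>" for w
        unfolding sets by (rule sets_prefix_pred)
    qed
    also have "\<dots> \<le> (\<Sum>w\<in>?W. C * (\<gamma> powi (- int ?n) * birkhoff_prod R ?n (point_of w)) * b ?n (sp w))"
    proof (rule sum_mono)
      fix w assume w: "w \<in> ?W"
      then have r: "point_of w \<in> X" "prefix ?n (point_of w) = w" using point_of by auto
      have "measure \<nu> {y \<in> X. prefix ?n y = prefix ?n (point_of w)} \<le>
          C * (\<gamma> powi (- int ?n) * birkhoff_prod R ?n (point_of w)) * \<Upsilon> (sp w)"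
        using C(2)[OF r(1), of ?n] r(2) by (simp add: mult.assoc)
      also have "\<dots> \<le> C * (\<gamma> powi (- int ?n) * birkhoff_prod R ?n (point_of w)) * b ?n (sp w)"
        using w pos by (intro mult_left_mono) auto
      finally show "measure \<nu> {y \<in> X. prefix ?n y = prefix ?n (point_of w)} \<le>
        C * (\<gamma> powi (- int ?n) * birkhoff_prod R ?n (point_of w)) * b ?n (sp w)" .
    qed
    also have "\<dots> \<le> (\<Sum>w\<in>prefix ?n ` X. C * (\<gamma> powi (- int ?n) * birkhoff_prod R ?n (point_of w)) * b ?n (sp w))"
      using fin by (intro sum_mono2 mult_nonneg_nonneg[OF pos] b0 sp_carrier) auto
    also have "\<dots> = C * ?S n" by (simp add: sum_distrib_left mult.assoc)
    finally show ?thesis .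
  qed
  have "summable (\<lambda>n. measure \<nu> (Bad n))"
    by (rule summable_comparison_test'[OF summable_mult[OF b, of C], of 0]) (use meas in simp)
  then have "AE y in \<nu>. eventually (\<lambda>n. y \<in> space \<nu> - Bad n) sequentially"
    using Bad_sets by (intro borel_cantelli_AE1) (auto simp: \<nu>.emeasure_eq_measure)
  then show ?thesis
  proof (rule AE_mp, intro AE_I2 impI)
    fix y assume "eventually (\<lambda>n. y \<in> space \<nu> - Bad n) sequentially"
    then obtain N where N: "\<And>n. n \<ge> N \<Longrightarrow> y \<in> X \<and> y \<notin> Bad n"
      by (auto simp: eventually_sequentially space)
    have "b n (sp (prefix n y)) \<le> \<Upsilon> (sp (prefix n y))" if "n \<ge> Suc N" for n
      using N[of "n - 1"] that by (cases n) (auto simp: Bad_def not_less)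
    then show "\<exists>N. \<forall>n\<ge>N. b n (sp (prefix n y)) \<le> \<Upsilon> (sp (prefix n y))" by blast
  qed
qed

text \<open>The powers of \<open>\<gamma>\<close> cancel, and the partition sums are bounded: the series is dominated by
  a multiple of \<open>\<Sum>n. n\<^sup>-\<^sup>2\<close>.\<close>

lemma AE_Upsilon_ge_gamma_power:
  "AE y in \<nu>. \<exists>N. \<forall>n\<ge>N. real n powi (- 2) * \<gamma> ^ n \<le> \<Upsilon> (sp (prefix n y))"
proof (rule AE_Upsilon_ge[where b = "\<lambda>n _. real n powi (- 2) * \<gamma> ^ n"])
  show "0 \<le> real n powi (- 2) * \<gamma> ^ n" for n using gamma_pos by simp
  obtain C where C: "C > 0"
    "\<And>n z. \<lbrakk>n \<ge> 1; \<And>w. w \<in> prefix n ` X \<Longrightarrow> z w \<in> X \<and> prefix n (z w) = w\<rbrakk> \<Longrightarrow>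
      (\<Sum>w\<in>prefix n ` X. birkhoff_prod R n (z w)) \<le> C"
    using prefix_sum_bounded[OF pressure_zero] by blast
  let ?f = "\<lambda>n. \<Sum>w\<in>prefix n ` X. \<gamma> powi (- int n) * birkhoff_prod R n (point_of w) * (real n powi (- 2) * \<gamma> ^ n)"
  have "summable (\<lambda>n. C * inverse (real (n + 1) ^ 2))"
    by (intro summable_mult summable_ignore_initial_segment inverse_power_summable) simp
  moreover have "norm (?f (Suc n)) \<le> C * inverse (real (n + 1) ^ 2)" for n
  proof -
    let ?n = "Suc n"
    have g: "\<gamma> powi (- int ?n) * \<gamma> ^ ?n = 1"
      using gamma_pos by (subst power_int_minus) (simp del: of_nat_Suc power_Suc)
    have r: "real ?n powi (- 2) = inverse (real (n + 1) ^ 2)"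
      by (simp add: power_int_minus)
    have "\<gamma> powi (- int ?n) * B * (real ?n powi (- 2) * \<gamma> ^ ?n) = inverse (real (n + 1) ^ 2) * B" for B
    proof -
      have "\<gamma> powi (- int ?n) * B * (real ?n powi (- 2) * \<gamma> ^ ?n) =
          (\<gamma> powi (- int ?n) * \<gamma> ^ ?n) * (real ?n powi (- 2) * B)" by (simp only: mult_ac)
      then show ?thesis by (simp only: g r mult_1)
    qed
    then have "?f ?n = (\<Sum>w\<in>prefix ?n ` X. inverse (real (n + 1) ^ 2) * birkhoff_prod R ?n (point_of w))"
      by (simp only:)
    also have "\<dots> = inverse (real (n + 1) ^ 2) * (\<Sum>w\<in>prefix ?n ` X. birkhoff_prod R ?n (point_of w))"
      by (simp only: sum_distrib_left)
    finally have eq: "?f ?n = \<dots>" .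
    have "(\<Sum>w\<in>prefix ?n ` X. birkhoff_prod R ?n (point_of w)) \<le> C" using point_of by (intro C(2)) auto
    moreover have "0 \<le> (\<Sum>w\<in>prefix ?n ` X. birkhoff_prod R ?n (point_of w))"
      using point_of by (intro sum_nonneg less_imp_le birkhoff_pos) auto
    ultimately show ?thesis unfolding eq by (simp add: mult.commute divide_right_mono field_simps)
  qed
  ultimately show "summable (\<lambda>n. ?f (Suc n))" by (rule summable_comparison_test'[where N = 0])
qed

text \<open>The factor \<open>(1 - \<epsilon>)\<^sup>n\<close> turns \<open>\<gamma>\<^sup>-\<^sup>n\<close> into \<open>t\<^sup>-\<^sup>n\<close> for some \<open>t > \<gamma>\<close>, where the density vector is
  still finite.\<close>

lemma AE_Upsilon_ge_inner:
  assumes \<epsilon>: "0 < \<epsilon>" "\<epsilon> < 1" and v: "v \<in> rep_cone G I H"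
  shows "AE y in \<nu>. \<exists>N. \<forall>n\<ge>N. (1 - \<epsilon>) ^ n * inner (\<rho> (sp (prefix n y)) f) v \<le> \<Upsilon> (sp (prefix n y))"
proof (rule AE_Upsilon_ge[where b = "\<lambda>n g. (1 - \<epsilon>) ^ n * inner (\<rho> g f) v"])
  have v0: "0 \<le> coord v p" for p using v by (rule rep_cone_nonneg)
  show b0: "0 \<le> (1 - \<epsilon>) ^ n * inner (\<rho> g f) v" if "g \<in> carrier G" for n g
    using \<epsilon> by (intro mult_nonneg_nonneg inner_coord_nonneg rho_nonneg[OF that] f_nonneg v0) auto
  define t where "t = \<gamma> / (1 - \<epsilon>)"
  have t: "t > \<gamma>" "t > 0" using \<epsilon> gamma_pos by (auto simp: t_def field_simps)
  let ?f = "\<lambda>n. \<Sum>w\<in>prefix n ` X. \<gamma> powi (- int n) * birkhoff_prod R n (point_of w) *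
    ((1 - \<epsilon>) ^ n * inner (\<rho> (sp w) f) v)"
  let ?q = "\<lambda>u. t powi (- int (length u)) * c (length u) * birkhoff_prod R (length u) (point_of u) *
    inner (\<rho> (\<one> \<otimes> sp u) f) v"
  show "summable (\<lambda>n. ?f (Suc n))"
  proof (rule summableI_nonneg_bounded)
    fix n
    have pos: "0 \<le> birkhoff_prod R m (point_of w)" "0 \<le> inner (\<rho> (sp w) f) v" if "w \<in> prefix m ` X" for m w
      using point_of[OF that] by (auto intro!: less_imp_le[OF birkhoff_pos] inner_coord_nonneg rho_nonneg f_nonneg v0 sp_carrier)
    show "0 \<le> ?f (Suc n)"
      using gamma_pos \<epsilon> by (intro sum_nonneg mult_nonneg_nonneg pos) auto
    let ?F = "\<Union>m\<in>Suc ` {..<n}. prefix m ` X"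
    have le: "c 0 * ?f m \<le> (\<Sum>u\<in>prefix m ` X. ?q u)" for m
      unfolding sum_distrib_left
    proof (rule sum_mono)
      fix w assume w: "w \<in> prefix m ` X"
      have "t powi (- int m) = \<gamma> powi (- int m) * (1 - \<epsilon>) ^ m"
        using \<epsilon> gamma_pos by (simp add: t_def power_int_minus power_divide field_simps)
      then have "c 0 * (\<gamma> powi (- int m) * birkhoff_prod R m (point_of w) * ((1 - \<epsilon>) ^ m * inner (\<rho> (sp w) f) v))
        = t powi (- int m) * c 0 * birkhoff_prod R m (point_of w) * inner (\<rho> (sp w) f) v" by simp
      also have "\<dots> \<le> t powi (- int m) * c m * birkhoff_prod R m (point_of w) * inner (\<rho> (sp w) f) v"
        using t pos[OF w] by (intro mult_right_mono mult_left_mono c_mono) auto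
      finally show "c 0 * (\<gamma> powi (- int m) * birkhoff_prod R m (point_of w) * ((1 - \<epsilon>) ^ m * inner (\<rho> (sp w) f) v)) \<le> ?q w"
        using point_of[OF w] sp_carrier by simp
    qed
    have "c 0 * (\<Sum>i<n. ?f (Suc i)) \<le> (\<Sum>i<n. \<Sum>u\<in>prefix (Suc i) ` X. ?q u)"
      unfolding sum_distrib_left[of "c 0" _ "{..<n}"] by (intro sum_mono le)
    also have "\<dots> = (\<Sum>m\<in>Suc ` {..<n}. \<Sum>u\<in>prefix m ` X. ?q u)"
      by (subst sum.reindex) auto
    also have "\<dots> = (\<Sum>u\<in>?F. ?q u)"
    proof (rule sum.UNION_disjoint[symmetric])
      show "\<forall>i\<in>Suc ` {..<n}. \<forall>j\<in>Suc ` {..<n}. i \<noteq> j \<longrightarrow> prefix i ` X \<inter> prefix j ` X = {}"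
      proof (intro ballI impI, rule equals0I)
        fix i j w assume "i \<noteq> j" "w \<in> prefix i ` X \<inter> prefix j ` X"
        then show False using point_of[of w i] point_of[of w j] by simp
      qed
    qed (simp_all add: finite_prefixes)
    also have "\<dots> \<le> bridge_const t * inner (\<rho> \<one> (\<Phi> t)) v"
    proof (rule sum_words_le_inner[OF t(1) order_refl _ one_closed v0])
      show "finite ?F" by (auto simp: finite_prefixes)
      fix u assume "u \<in> ?F"
      then obtain m where "u \<in> prefix (Suc m) ` X" by auto
      then show "u \<noteq> [] \<and> point_of u \<in> X \<and> prefix (length u) (point_of u) = u" using point_of by fastforce
    qed
    finally show "(\<Sum>i<n. ?f (Suc i)) \<le> bridge_const t * inner (\<rho> \<one> (\<Phi> t)) v / c 0"
      using c_pos[of 0] by (simp add: pos_le_divide_eq mult.commute)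
  qed
qed

end

theorem lemma3p11:
  fixes \<tau> :: "'a::finite \<Rightarrow> 'a \<Rightarrow> bool"
    and R :: "'a word \<Rightarrow> real"
    and G :: "('g, 'm) monoid_scheme"
    and s :: "'a \<Rightarrow> 'g"
    and I :: "'i set"
    and H :: "'i \<Rightarrow> 'g set"
    and A a :: 'a
    and x :: "'a word"
    and f :: "('i \<times> 'g set) ell2"
    and \<gamma> :: real
    and c :: "nat \<Rightarrow> real"
    and tk :: "nat \<Rightarrow> real"
    and \<nu> :: "'a word measure"
    and \<Upsilon> :: "'g \<Rightarrow> real"
  assumes "compact_space (shift_top \<tau>)"
    and "topologically_mixing \<tau>"
    and "\<forall>y\<in>shift_space \<tau>. R y > 0"
    and "log_regular \<tau> R"
    and "\<forall>B. pressure \<tau> R B = 0"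
    and "group G"
    and "countable (carrier G)"
    and "\<forall>b. s b \<in> carrier G"
    and "transitive_extension \<tau> G s"
    and "countable I"
    and "\<forall>i\<in>I. subgroup (H i) G"
    and "\<tau> a A"
    and "x \<in> shift_space \<tau>"
    and "x 0 = A"
    and "\<forall>i\<ge>1. x i \<noteq> A"
    and "f \<in> rep_cone G I H"
    and "f \<noteq> 0"
    and "\<gamma> = gamma_exponent \<tau> R G s A a x I H f"
    and "\<gamma> < 1"
    and "slowly_increasing c"
    and "\<forall>t>\<gamma>. phi_vec_finite \<tau> R G s A a x I H f c t"
    and "filterlim (\<lambda>t. norm (phi_vec \<tau> R G s A a x I H f c t)) at_top (at_right \<gamma>)"
    and "\<forall>k. tk k > \<gamma>"
    and "tk \<longlonglongrightarrow> \<gamma>"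
    and "weak_star_limit (shift_top \<tau>) (\<lambda>k. twisted_sum \<tau> R G s A a x I H f c (tk k)) \<nu>"
    and "\<forall>g\<in>carrier G. (\<lambda>k.
        inner (quot_rep G I H g (phi_vec \<tau> R G s A a x I H f c (tk k)))
              (phi_vec \<tau> R G s A a x I H f c (tk k))
        / (norm (phi_vec \<tau> R G s A a x I H f c (tk k)))\<^sup>2) \<longlonglongrightarrow> \<Upsilon> g"
  shows "(\<forall>\<epsilon>\<in>{0<..<1}. \<forall>v\<in>rep_cone G I H. AE z in \<nu>. \<exists>N. \<forall>n\<ge>N.
            inner (quot_rep G I H (word_prod G s (prefix n z)) f) v
            \<le> (1 - \<epsilon>) powi (- int n) * \<Upsilon> (word_prod G s (prefix n z)))
       \<and> (AE z in \<nu>. \<exists>N. \<forall>n\<ge>N.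
            \<Upsilon> (word_prod G s (prefix n z)) \<ge> real n powi (- 2) * \<gamma> ^ n)"
proof -
  interpret group G by fact
  interpret twisted_walk \<tau> R G s A a x I H f c \<gamma>
  proof (unfold_locales)
    show "R y > 0" if "y \<in> shift_space \<tau>" for y using assms(3) that by blast
    show "shift_space \<tau> \<noteq> {}" using assms(13) by blast
    show "s b \<in> carrier G" for b using assms(8) by blast
    show "phi_vec_finite \<tau> R G s A a x I H f c t" if "t > \<gamma>" for t using assms(21) that by blast
  qed (fact assms)+
  interpret twisted_limit \<tau> R G s A a x I H f c \<gamma> tk \<nu> \<Upsilon>
  proof (unfold_locales)
    show "tk k > \<gamma>" for k using assms(23) by blast
    show "pressure \<tau> R A = 0" using assms(5) by blast
    show "(\<lambda>k. Upsilon_at (tk k) g) \<longlonglongrightarrow> \<Upsilon> g" if "g \<in> carrier G" for g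
      using assms(26) that unfolding Upsilon_at_def by blast
  qed (fact assms)+
  have "AE z in \<nu>. \<exists>N. \<forall>n\<ge>N. inner (\<rho> (sp (prefix n z)) f) v
      \<le> (1 - \<epsilon>) powi (- int n) * \<Upsilon> (sp (prefix n z))"
    if \<epsilon>: "\<epsilon> \<in> {0<..<1}" and v: "v \<in> rep_cone G I H" for \<epsilon> :: real and v
  proof -
    have "r \<le> (1 - \<epsilon>) powi (- int n) * u \<longleftrightarrow> (1 - \<epsilon>) ^ n * r \<le> u" for n r u
      using \<epsilon> by (simp add: power_int_minus field_simps)
    then show ?thesis using AE_Upsilon_ge_inner[of \<epsilon> v] \<epsilon> v by simp
  qed
  then show ?thesis using AE_Upsilon_ge_gamma_power by blast
qed

end
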